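(* Let $p_1<p_2$ and $\tilde p_1<\tilde p_2$ be finite real numbers such that $[p_1,p_2]\subset(\tilde p_1,\tilde p_2)$. Let $f$ be a symbol with $f''>0$ as in the context and let $u_0\in\mathcal S(\mathbb R)$ satisfy $\mathrm{supp}\,\mathcal F u_0\subseteq[p_1,p_2]$. Fix $(t_0,x_0)\in\mathbb R^2$. Then: (i) for every $\delta\in\big(\frac12,\frac34\big)$ and all $(t,x)\in\mathfrak C_f\big([\tilde p_1,\tilde p_2],(t_0,x_0)\big)$, with $p_0(t,x):=(f')^{-1}\big(\frac{x-x_0}{t-t_0}\big)$, we have $$\left|u_f(t,x)-\frac1{\sqrt{2\pi}}\,e^{-\mathrm{sgn}(t-t_0)i\frac\pi4}\,e^{-itf(p_0(t,x))+ixp_0(t,x)}\,\frac{\mathcal F u_0(p_0(t,x))}{\sqrt{f''(p_0(t,x))}}\,|t-t_0|^{-\frac12}\right|$$ $$\leqslant\Big(C_5(f,\delta,\tilde p_1,\tilde p_2)\,\|(\cdot-x_0)\,u_f(t_0,\cdot)\|_{L^2(\mathbb R)}+C_6(f,\delta,\tilde p_1,\tilde p_2)\,\|u_0\|_{L^1(\mathbb R)}\Big)|t-t_0|^{-\delta},$$ where, writing $\|\cdot\|_\infty$ for the norm of $L^\infty(\tilde p_1,\tilde p_2)$ and $m=\min_{[\tilde p_1,\tilde p_2]}f''$, $$C_5(f,\delta,\tilde p_1,\tilde p_2)=\frac{2^{\delta+\frac12}L(\delta)}{\sqrt\pi\sqrt{3-4\delta}}(\tilde p_2-\tilde p_1)^{\frac{3-4\delta}2}\,\|f''\|_\infty^{\frac32-\delta}m^{-\frac32},$$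 $$C_6(f,\delta,\tilde p_1,\tilde p_2)=\frac{2^{\delta-2}L(\delta)}{\pi(1-\delta)}(\tilde p_2-\tilde p_1)^{2-2\delta}\Big(\|f''\|_\infty^{\frac52-\delta}\|f^{(3)}\|_\infty m^{-\frac72}+\tfrac13\|f''\|_\infty^{\frac72-\delta}\|f^{(3)}\|_\infty m^{-\frac92}\Big),$$ $$L(\delta)=\frac{\sqrt\pi}2\Big(\frac1{2\sqrt\pi}+\sqrt{\frac1{4\pi}+\frac12}\Big)^{2\delta-1};$$ (ii) for all $(t,x)\in\mathfrak C_f\big([\tilde p_1,\tilde p_2],(t_0,x_0)\big)^c$, we have $$|u_f(t,x)|\leqslant\Big(C_7(f,p_1,p_2,\tilde p_1,\tilde p_2)\,\|(\cdot-x_0)\,u_f(t_0,\cdot)\|_{L^2(\mathbb R)}+C_8(f,p_1,p_2,\tilde p_1,\tilde p_2)\,\|u_0\|_{L^1(\mathbb R)}\Big)|t-t_0|^{-1},$$ where $$C_7(f,p_1,p_2,\tilde p_1,\tilde p_2)=\frac1{\sqrt{2\pi}}(p_2-p_1)^{\frac12}\min\{f'(p_1)-f'(\tilde p_1),f'(\tilde p_2)-f'(p_2)\}^{-1},$$ $$C_8(f,p_1,p_2,\tilde p_1,\tilde p_2)=\frac1{2\pi}\min\{f'(p_1)-f'(\tilde p_1),f'(\tilde p_2)-f'(p_2)\}^{-1}.$$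
   Context: Fourier transform: $\mathcal F u(p)=\int_{\mathbb R}u(x)e^{-ixp}\,dx$. The symbol $f:\mathbb R\to\mathbb R$ is $\mathcal C^\infty$, all its derivatives grow at most polynomially at infinity, and $f''>0$ on $\mathbb R$. The wave packet is $u_f(t,x)=\frac1{2\pi}\int_{\mathbb R}\mathcal F u_0(p)\,e^{-itf(p)+ixp}\,dp$, the solution of $[i\partial_t-f(D)]u_f(t)=0$, $u_f(0)=u_0$, where $f(D)u=\mathcal F^{-1}(f\,\mathcal F u)$. Space-time cone: for $(t_0,x_0)\in\mathbb R^2$, $$\mathfrak C_f\big([\tilde p_1,\tilde p_2],(t_0,x_0)\big)=\Big\{(t,x)\in(\mathbb R\setminus\{t_0\})\times\mathbb R\;\Big|\;f'(\tilde p_1)\leqslant\tfrac{x-x_0}{t-t_0}\leqslant f'(\tilde p_2)\Big\},$$ and $\mathfrak C_f(\dots)^c$ is its complement in $(\mathbb R\setminus\{t_0\})\times\mathbb R$. *)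

theory Defs
  imports "HOL-Analysis.Analysis" "HOL-Probability.Essential_Supremum"
begin

definition symbol_class :: "(real \<Rightarrow> real) \<Rightarrow> bool" where
  "symbol_class f \<longleftrightarrow>
     (\<forall>k x. ((deriv ^^ k) f) differentiable (at x)) \<and>
     (\<forall>k. \<exists>C N. \<forall>x. \<bar>(deriv ^^ k) f x\<bar> \<le> C * (1 + \<bar>x\<bar>) ^ N)"

text \<open>
  Since \<open>deriv\<close> is a field derivative, derivatives of complex-valued functions of a real
  variable are taken with \<open>vector_derivative\<close>.
\<close>

definition vderiv :: "(real \<Rightarrow> complex) \<Rightarrow> real \<Rightarrow> complex" where
  "vderiv u = (\<lambda>x. vector_derivative u (at x))"

definition schwartz :: "(real \<Rightarrow> complex) \<Rightarrow> bool" where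
  "schwartz u \<longleftrightarrow>
     (\<forall>k x. ((vderiv ^^ k) u) differentiable (at x)) \<and>
     (\<forall>j k. \<exists>C. \<forall>x. \<bar>x\<bar> ^ j * cmod ((vderiv ^^ k) u x) \<le> C)"

definition fourier :: "(real \<Rightarrow> complex) \<Rightarrow> real \<Rightarrow> complex" where
  "fourier u p = (LINT x|lborel. u x * exp (- \<i> * of_real x * of_real p))"

definition supp :: "(real \<Rightarrow> complex) \<Rightarrow> real set" where
  "supp g = closure {p. g p \<noteq> 0}"

definition wave_packet :: "(real \<Rightarrow> real) \<Rightarrow> (real \<Rightarrow> complex) \<Rightarrow> real \<Rightarrow> real \<Rightarrow> complex" where
  "wave_packet f u0 t x =
     1 / (2 * of_real pi) *
     (LINT p|lborel. fourier u0 p *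
        exp (- \<i> * of_real t * of_real (f p) + \<i> * of_real x * of_real p))"

definition st_cone :: "(real \<Rightarrow> real) \<Rightarrow> real \<Rightarrow> real \<Rightarrow> real \<Rightarrow> real \<Rightarrow> (real \<times> real) set" where
  "st_cone f q1 q2 t0 x0 =
     {(t, x). t \<noteq> t0 \<and> deriv f q1 \<le> (x - x0) / (t - t0) \<and> (x - x0) / (t - t0) \<le> deriv f q2}"

definition st_cone_compl :: "(real \<Rightarrow> real) \<Rightarrow> real \<Rightarrow> real \<Rightarrow> real \<Rightarrow> real \<Rightarrow> (real \<times> real) set" where
  "st_cone_compl f q1 q2 t0 x0 = (UNIV - {t0}) \<times> UNIV - st_cone f q1 q2 t0 x0"

text \<open>
  If \<open>f'' > 0\<close> then \<open>f'\<close> is injective but in general not onto. The value is used only on the cone,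
  where \<open>(x - x0) / (t - t0)\<close> lies in the range of \<open>f'\<close>.
\<close>

definition stat_point :: "(real \<Rightarrow> real) \<Rightarrow> real \<Rightarrow> real \<Rightarrow> real \<Rightarrow> real \<Rightarrow> real" where
  "stat_point f t0 x0 t x = inv (deriv f) ((x - x0) / (t - t0))"

definition L1_norm :: "(real \<Rightarrow> complex) \<Rightarrow> real" where
  "L1_norm g = (LINT x|lborel. cmod (g x))"

definition L2_norm :: "(real \<Rightarrow> complex) \<Rightarrow> real" where
  "L2_norm g = sqrt (LINT x|lborel. (cmod (g x))\<^sup>2)"

definition Linf_norm :: "real \<Rightarrow> real \<Rightarrow> (real \<Rightarrow> real) \<Rightarrow> real" where
  "Linf_norm a b g =
     real_of_ereal (esssup (restrict_space lborel {a<..<b}) (\<lambda>x. ereal \<bar>g x\<bar>))"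

text \<open>For continuous \<open>g\<close> and \<open>a \<le> b\<close> the infimum below is attained, so it is the minimum.\<close>

definition min_on :: "real \<Rightarrow> real \<Rightarrow> (real \<Rightarrow> real) \<Rightarrow> real" where
  "min_on a b g = (INF x\<in>{a..b}. g x)"

definition L_const :: "real \<Rightarrow> real" where
  "L_const \<delta> =
     sqrt pi / 2 * (1 / (2 * sqrt pi) + sqrt (1 / (4 * pi) + 1 / 2)) powr (2 * \<delta> - 1)"

definition C5 :: "(real \<Rightarrow> real) \<Rightarrow> real \<Rightarrow> real \<Rightarrow> real \<Rightarrow> real" where
  "C5 f \<delta> q1 q2 =
     2 powr (\<delta> + 1 / 2) * L_const \<delta> / (sqrt pi * sqrt (3 - 4 * \<delta>)) *
     (q2 - q1) powr ((3 - 4 * \<delta>) / 2) *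
     Linf_norm q1 q2 ((deriv ^^ 2) f) powr (3 / 2 - \<delta>) *
     min_on q1 q2 ((deriv ^^ 2) f) powr (- 3 / 2)"

definition C6 :: "(real \<Rightarrow> real) \<Rightarrow> real \<Rightarrow> real \<Rightarrow> real \<Rightarrow> real" where
  "C6 f \<delta> q1 q2 =
     2 powr (\<delta> - 2) * L_const \<delta> / (pi * (1 - \<delta>)) *
     (q2 - q1) powr (2 - 2 * \<delta>) *
     (Linf_norm q1 q2 ((deriv ^^ 2) f) powr (5 / 2 - \<delta>) *
        Linf_norm q1 q2 ((deriv ^^ 3) f) *
        min_on q1 q2 ((deriv ^^ 2) f) powr (- 7 / 2) +
      1 / 3 * Linf_norm q1 q2 ((deriv ^^ 2) f) powr (7 / 2 - \<delta>) *
        Linf_norm q1 q2 ((deriv ^^ 3) f) *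
        min_on q1 q2 ((deriv ^^ 2) f) powr (- 9 / 2))"

definition C7 :: "(real \<Rightarrow> real) \<Rightarrow> real \<Rightarrow> real \<Rightarrow> real \<Rightarrow> real \<Rightarrow> real" where
  "C7 f p1 p2 q1 q2 =
     1 / sqrt (2 * pi) * (p2 - p1) powr (1 / 2) *
     inverse (min (deriv f p1 - deriv f q1) (deriv f q2 - deriv f p2))"

definition C8 :: "(real \<Rightarrow> real) \<Rightarrow> real \<Rightarrow> real \<Rightarrow> real \<Rightarrow> real \<Rightarrow> real" where
  "C8 f p1 p2 q1 q2 =
     1 / (2 * pi) * inverse (min (deriv f p1 - deriv f q1) (deriv f q2 - deriv f p2))"

end

theory Submission
  imports Defs "HOL-Probability.Characteristic_Functions" "HOL-Probability.Sinc_Integral"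
begin

text \<open>
  Put \<open>s = t - t0\<close>. Translating the origin to \<open>(t0, x0)\<close> turns the packet into
  \<open>1 / (2 pi) \<integral> U(p) e^(-i (s f(p) - (x - x0) p)) dp\<close>, where
  \<open>U(p) = e^(i x0 p - i t0 f(p)) (F u0)(p)\<close> is supported in \<open>[p1, p2]\<close>. Only two quantities of the
  datum enter the estimates: the trivial bound \<open>|U| \<le> ||u0||_1\<close>, and the energy
  \<open>||U'||_2\<^sup>2 = 2 pi ||(. - x0) u_f(t0, .)||_2\<^sup>2\<close>, which is Plancherel's identity, because \<open>U'\<close> is up to
  the factor \<open>e^(i x0 p)\<close> the Fourier transform of \<open>-i (y - x0) u_f(t0, y)\<close>
  (\<open>profile'_energy\<close>). Everything else concerns oscillatory integrals.

  Outside the cone the phase derivative \<open>f' - (x - x0) / s\<close> has a fixed sign and modulus at least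
  \<open>\<mu> = min (f'(p1) - f'(q1)) (f'(q2) - f'(p2))\<close> on the support of \<open>U\<close>. One integration by parts gains
  \<open>1 / |s|\<close>; the monotonicity of \<open>f'\<close> makes the term with \<open>f''\<close> integrate exactly
  (\<open>nonstationary_phase_bound\<close>).

  Inside the cone there is a stationary point \<open>p0\<close>. Each side of it is treated separately. With
  \<open>F(h)\<close> the Taylor remainder of the phase at \<open>p0\<close>, the substitution \<open>\<sigma> = sqrt (F(h))\<close> turns the
  oscillating factor into \<open>e^(-i \<sigma>\<^sup>2)\<close>, whose primitive is minus the Fresnel tail
  \<open>\<integral>_\<sigma>^\<infinity> e^(-i r\<^sup>2) dr\<close>. Integrating by parts against this primitive, the boundary term at the
  stationary point is exactly half of the leading term, the other boundary term vanishes with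
  \<open>U\<close>, and the remainder is an integral of the derivative of \<open>U dh/d\<sigma>\<close> against the tail. Since the
  tail is bounded by \<open>sqrt pi / 2\<close> and by \<open>1 / (sqrt 2 \<sigma>)\<close>, interpolation bounds it
  by a multiple of \<open>\<sigma>^(1 - 2 \<delta>)\<close> (\<open>norm_fresnel_tail_le\<close>). As \<open>\<sigma>\<close> is proportional to
  \<open>|s|^(1 / 2)\<close>, a larger \<open>\<delta>\<close> means faster decay in time and a stronger singularity
  \<open>|h|^(1 - 2 \<delta>)\<close> at the stationary point. This singularity is paired with \<open>U'\<close>, which is only
  controlled in \<open>L\<^sup>2\<close>, hence must be square integrable: \<open>\<delta> < 3 / 4\<close> (\<open>one_sided_expansion\<close>,
  \<open>stationary_phase_bound\<close>).
\<close>

section \<open>Differentiation under the integral sign\<close>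

text \<open>
  By the mean value inequality each \<open>f _ x\<close> is Lipschitz with constant \<open>w x\<close>, so the difference
  quotients are dominated by \<open>w\<close> and dominated convergence applies. Derivatives are taken within a
  convex set because the integrand of the Fresnel factor below is dominated on a closed half-line.
\<close>

lemma has_vector_derivative_LINT:
  fixes f :: "real \<Rightarrow> 'a \<Rightarrow> 'b::{banach,second_countable_topology}"
  assumes S: "convex S" "s \<in> S"
    and int: "\<And>s. s \<in> S \<Longrightarrow> integrable M (f s)"
    and der: "\<And>s x. s \<in> S \<Longrightarrow> x \<in> space M \<Longrightarrow>
      ((\<lambda>s. f s x) has_vector_derivative f' s x) (at s within S)"
    and bnd: "\<And>s x. s \<in> S \<Longrightarrow> x \<in> space M \<Longrightarrow> norm (f' s x) \<le> w x"
    and w: "integrable M w"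
    and meas: "f' s \<in> borel_measurable M"
  shows "((\<lambda>s. \<integral>x. f s x \<partial>M) has_vector_derivative (\<integral>x. f' s x \<partial>M)) (at s within S)"
proof -
  have int': "integrable M (f' s)"
    by (rule Bochner_Integration.integrable_bound[OF w meas])
       (use bnd[OF S(2)] in \<open>auto intro!: AE_I2 order_trans[OF _ abs_ge_self]\<close>)
  have lip: "norm (f y x - f s x) \<le> w x * \<bar>y - s\<bar>" if "y \<in> S" "x \<in> space M" for x y
  proof -
    have "norm (f y x - f s x) \<le> w x * norm (y - s)"
    proof (rule differentiable_bound[OF S(1) _ _ \<open>y \<in> S\<close> S(2)])
      fix z assume z: "z \<in> S"
      show "((\<lambda>s. f s x) has_derivative (\<lambda>h. h *\<^sub>R f' z x)) (at z within S)"
        using der[OF z that(2)] by (simp add: has_vector_derivative_def)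
      show "onorm (\<lambda>h. h *\<^sub>R f' z x) \<le> w x"
        by (rule onorm_bound)
           (use bnd[OF z that(2)] order_trans[OF norm_ge_zero bnd[OF z that(2)]] in
             \<open>auto simp: mult.commute intro!: mult_left_mono\<close>)
    qed
    then show ?thesis by simp
  qed
  let ?q = "\<lambda>y x. norm (f y x - f s x - (y - s) *\<^sub>R f' s x) / norm (y - s)"
  have lim: "((\<lambda>y. \<integral>x. ?q y x \<partial>M) \<longlongrightarrow> 0) (at s within S)"
    unfolding tendsto_at_iff_sequentially comp_def
  proof (intro allI impI)
    fix X :: "nat \<Rightarrow> real"
    assume X: "\<forall>i. X i \<in> S - {s}" "X \<longlonglongrightarrow> s"
    have "(\<lambda>i. \<integral>x. ?q (X i) x \<partial>M) \<longlonglongrightarrow> (\<integral>x. 0 \<partial>M)"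
    proof (rule integral_dominated_convergence[where w="\<lambda>x. 2 * w x"])
      show "?q (X i) \<in> borel_measurable M" for i
      proof -
        have [measurable]: "f (X i) \<in> borel_measurable M" "f s \<in> borel_measurable M"
          using X(1) S(2) int by auto
        show ?thesis using meas by measurable
      qed
      show "AE x in M. (\<lambda>i. ?q (X i) x) \<longlonglongrightarrow> 0"
      proof (rule AE_I2)
        fix x assume x: "x \<in> space M"
        have "((\<lambda>y. ?q y x) \<longlongrightarrow> 0) (at s within S)"
          using der[OF S(2) x] by (simp add: has_vector_derivative_def has_derivative_iff_norm)
        then show "(\<lambda>i. ?q (X i) x) \<longlonglongrightarrow> 0"
          using X by (auto simp: tendsto_at_iff_sequentially comp_def)
      qed
      show "AE x in M. norm (?q (X i) x) \<le> 2 * w x" for i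
      proof (rule AE_I2)
        fix x assume x: "x \<in> space M"
        have Xi: "X i \<in> S" "X i \<noteq> s" using X(1) by auto
        have "norm (f (X i) x - f s x - (X i - s) *\<^sub>R f' s x)
            \<le> w x * \<bar>X i - s\<bar> + \<bar>X i - s\<bar> * w x"
          using lip[OF Xi(1) x] mult_left_mono[OF bnd[OF S(2) x] abs_ge_zero[of "X i - s"]]
            norm_triangle_ineq4[of "f (X i) x - f s x" "(X i - s) *\<^sub>R f' s x"]
          unfolding norm_scaleR real_norm_def by linarith
        then show "norm (?q (X i) x) \<le> 2 * w x"
          using Xi(2) by (simp add: divide_simps algebra_simps)
      qed
    qed (use w in auto)
    then show "(\<lambda>i. \<integral>x. ?q (X i) x \<partial>M) \<longlonglongrightarrow> 0" by simp
  qed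
  show ?thesis
    unfolding has_vector_derivative_def has_derivative_iff_norm
  proof (intro conjI)
    show "bounded_linear (\<lambda>h. h *\<^sub>R (\<integral>x. f' s x \<partial>M))"
      by (rule bounded_linear_scaleR_left)
    show "((\<lambda>y. norm ((\<integral>x. f y x \<partial>M) - (\<integral>x. f s x \<partial>M) - (y - s) *\<^sub>R (\<integral>x. f' s x \<partial>M)) /
        norm (y - s)) \<longlongrightarrow> 0) (at s within S)"
    proof (rule tendsto_sandwich[OF _ _ tendsto_const lim])
      show "\<forall>\<^sub>F y in at s within S. norm ((\<integral>x. f y x \<partial>M) - (\<integral>x. f s x \<partial>M) -
          (y - s) *\<^sub>R (\<integral>x. f' s x \<partial>M)) / norm (y - s) \<le> (\<integral>x. ?q y x \<partial>M)"
        unfolding eventually_at_filter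
      proof (intro always_eventually allI impI)
        fix y assume y: "y \<noteq> s" "y \<in> S"
        have "(\<integral>x. f y x \<partial>M) - (\<integral>x. f s x \<partial>M) - (y - s) *\<^sub>R (\<integral>x. f' s x \<partial>M) =
            (\<integral>x. f y x - f s x - (y - s) *\<^sub>R f' s x \<partial>M)"
          using int y S(2) int' by simp
        also have "norm \<dots> \<le> (\<integral>x. norm (f y x - f s x - (y - s) *\<^sub>R f' s x) \<partial>M)"
          by (rule integral_norm_bound)
        finally show "norm ((\<integral>x. f y x \<partial>M) - (\<integral>x. f s x \<partial>M) -
          (y - s) *\<^sub>R (\<integral>x. f' s x \<partial>M)) / norm (y - s) \<le> (\<integral>x. ?q y x \<partial>M)"
          using y by (simp add: divide_right_mono)
      qed
    qed auto
  qed
qed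

lemma has_vector_derivative_cis: "(cis has_vector_derivative \<i> * cis x) (at x)"
proof -
  have "((\<lambda>z. exp (\<i> * z)) has_field_derivative exp (\<i> * of_real x) * \<i>) (at (of_real x))"
    by (auto intro!: derivative_eq_intros)
  from has_vector_derivative_real_field[OF this, of UNIV]
  show ?thesis by (simp add: cis_conv_exp[abs_def] mult.commute)
qed

section \<open>The Fresnel tail\<close>

text \<open>
  The integrand \<open>e^(-i \<sigma>\<^sup>2)\<close> of the Fresnel tail along the ray \<open>\<sigma> = s + e^(-i pi / 4) r\<close>, with the
  factor \<open>e^(-i s\<^sup>2)\<close> split off. On this ray the oscillation has become Gaussian decay.
\<close>

definition rotated_gaussian :: "real \<Rightarrow> real \<Rightarrow> complex" where
  "rotated_gaussian s r = exp (- of_real (r\<^sup>2) - of_real (2 * s * r) * cis (pi / 4))"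

definition fresnel_factor :: "real \<Rightarrow> complex" where
  "fresnel_factor s =
     (LINT r|lborel. indicator {0..} r *\<^sub>R rotated_gaussian s r)"

text \<open>
  This is \<open>\<integral>_s^\<infinity> e^(-i \<sigma>\<^sup>2) d\<sigma>\<close> with the path of integration rotated. Starting from the rotated
  integral makes it absolutely convergent; its defining properties are checked by differentiation
  under the integral, so that no contour has to be moved.
\<close>

definition fresnel_tail :: "real \<Rightarrow> complex" where
  "fresnel_tail s = cis (- s\<^sup>2) * cis (- (pi / 4)) * fresnel_factor s"

lemma borel_measurable_rotated_gaussian [measurable]:
  "rotated_gaussian s \<in> borel_measurable borel"
  unfolding rotated_gaussian_def by measurable

lemma norm_rotated_gaussian:
  "norm (rotated_gaussian s r) =
   exp (- r\<^sup>2 - sqrt 2 * s * r)"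
proof -
  have "(2::real) / sqrt 2 = sqrt 2" by (simp add: real_div_sqrt)
  then show ?thesis by (simp add: rotated_gaussian_def cos_45 field_simps power2_eq_square)
qed

lemma integrable_fresnel:
  fixes s :: real
  assumes "0 \<le> s"
  shows "integrable lborel (\<lambda>r. indicator {0..} r *\<^sub>R
           (of_real r ^ k * rotated_gaussian s r))"
    (is "integrable lborel ?f")
proof (rule Bochner_Integration.integrable_bound)
  have "integrable lborel (\<lambda>r. indicator {0..} r *\<^sub>R (exp (- r\<^sup>2) * r ^ k) :: real)"
  proof (cases "even k")
    case True
    then show ?thesis
      using gaussian_moment_even_pos[of "k div 2", THEN integrable.intros] by simp
  next
    case False
    then show ?thesis
      using gaussian_moment_odd_pos[of "k div 2", THEN integrable.intros] by simp
  qed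
  then show "integrable lborel (\<lambda>r. indicator {0..} r *\<^sub>R (exp (- r\<^sup>2) * r ^ k) :: real)" .
  show "?f \<in> borel_measurable lborel" by measurable
  show "AE r in lborel. norm (?f r) \<le> norm (indicator {0..} r *\<^sub>R (exp (- r\<^sup>2) * r ^ k) :: real)"
    using assms
    by (intro AE_I2)
       (auto simp: norm_mult norm_power indicator_def mult.commute
             simp: norm_rotated_gaussian intro!: mult_left_mono)
qed

lemma fresnel_factor_0: "fresnel_factor 0 = of_real (sqrt pi / 2)"
proof -
  have "fresnel_factor 0 = (LINT r|lborel. of_real (indicator {0..} r *\<^sub>R exp (- r\<^sup>2)))"
    unfolding fresnel_factor_def
    by (intro Bochner_Integration.integral_cong) (auto simp: rotated_gaussian_def exp_of_real indicator_def simp flip: of_real_minus of_real_power)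
  also have "\<dots> = of_real (sqrt pi / 2)"
    unfolding integral_complex_of_real gaussian_moment_0[THEN has_bochner_integral_integral_eq] ..
  finally show ?thesis .
qed

lemma norm_fresnel_factor_le:
  assumes "0 \<le> s"
  shows "norm (fresnel_factor s) \<le> sqrt pi / 2"
proof -
  have "norm (fresnel_factor s) \<le> (LINT r|lborel. indicator {0..} r *\<^sub>R exp (- r\<^sup>2))"
    unfolding fresnel_factor_def
  proof (rule Bochner_Integration.integral_norm_bound_integral)
    show "integrable lborel (\<lambda>r. indicator {0..} r *\<^sub>R rotated_gaussian s r)"
      using integrable_fresnel[OF assms, of 0] by simp
    show "integrable lborel (\<lambda>r::real. indicator {0..} r *\<^sub>R exp (- r\<^sup>2))"
      by (rule integrable.intros[OF gaussian_moment_0])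
  qed (use assms in \<open>auto simp: indicator_def norm_rotated_gaussian\<close>)
  also have "\<dots> = sqrt pi / 2"
    using gaussian_moment_0 by (rule has_bochner_integral_integral_eq)
  finally show ?thesis .
qed

text \<open>
  Dropping the Gaussian factor \<open>e^(-r\<^sup>2)\<close> leaves an exponential integral.
\<close>

lemma norm_fresnel_factor_le_inverse:
  assumes "0 < s"
  shows "norm (fresnel_factor s) \<le> 1 / (sqrt 2 * s)"
proof -
  let ?g = "\<lambda>r. indicator {0..} r *\<^sub>R exp (- (r * (sqrt 2 * s)))"
  have g: "has_bochner_integral lborel ?g (1 / (sqrt 2 * s))"
  proof -
    let ?l = "sqrt 2 * s"
    have l: "?l > 0" using assms by simp
    interpret prob_space "density lborel (exponential_density ?l)"
      using l by (rule prob_space_exponential_density)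
    have "integrable lborel (exponential_density ?l)"
      using exponential_density_nonneg[OF l]
      by (intro integrableI_nonneg) (use emeasure_space_1 in \<open>auto simp: emeasure_density\<close>)
    moreover have "integral\<^sup>L lborel (exponential_density ?l) = 1"
      using exponential_density_nonneg[OF l] emeasure_space_1
      by (subst integral_eq_nn_integral) (auto simp: emeasure_density)
    ultimately have "has_bochner_integral lborel (exponential_density ?l) 1"
      by (simp add: has_bochner_integral_iff)
    then have "has_bochner_integral lborel (\<lambda>r. (1 / ?l) * exponential_density ?l r) ((1 / ?l) * 1)"
      by (rule has_bochner_integral_mult_right)
    also have "(\<lambda>r. (1 / ?l) * exponential_density ?l r) = ?g"
      using assms by (auto simp: fun_eq_iff exponential_density_def indicator_def)
    finally show ?thesis by simp
  qed
  have "norm (fresnel_factor s) \<le> (LINT r|lborel. ?g r)"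
    unfolding fresnel_factor_def
  proof (rule Bochner_Integration.integral_norm_bound_integral)
    show "integrable lborel (\<lambda>r. indicator {0..} r *\<^sub>R rotated_gaussian s r)"
      using integrable_fresnel[of s 0] assms by simp
    show "integrable lborel ?g"
      using g by (rule integrable.intros)
  qed (use assms in \<open>auto simp: indicator_def norm_rotated_gaussian mult_ac\<close>)
  also have "\<dots> = 1 / (sqrt 2 * s)"
    using g by (rule has_bochner_integral_integral_eq)
  finally show ?thesis .
qed

text \<open>
  The integrand is the derivative of the rotated Gaussian, which runs from 1 to 0 on the half-line.
\<close>

lemma integral_derivative_fresnel:
  assumes "0 \<le> s"
  shows "(LINT r|lborel. indicator {0..} r *\<^sub>R
           ((- 2 * of_real r - 2 * of_real s * cis (pi / 4)) *
            rotated_gaussian s r)) = - 1"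
    (is "(LINT r|lborel. indicator {0..} r *\<^sub>R ?f r) = - 1")
proof -
  let ?E = "rotated_gaussian s"
  have int: "integrable lborel (\<lambda>r. indicator {0..} r *\<^sub>R ?f r)"
  proof -
    have "integrable lborel (\<lambda>r. (- 2) * (indicator {0..} r *\<^sub>R (of_real r ^ 1 * ?E r))
        + (- 2 * of_real s * cis (pi / 4)) * (indicator {0..} r *\<^sub>R (of_real r ^ 0 * ?E r)))"
      by (intro Bochner_Integration.integrable_add integrable_mult_right integrable_fresnel assms)
    then show ?thesis
      by (rule Bochner_Integration.integrable_cong[THEN iffD1, rotated 2])
         (auto simp: indicator_def algebra_simps)
  qed
  have AE: "AE r in lborel. indicator {0<..} r *\<^sub>R ?f r = indicator {0..} r *\<^sub>R ?f r"
    using AE_lborel_singleton[of 0] by eventually_elim (auto simp: indicator_def)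
  have int': "integrable lborel (\<lambda>r. indicator {0<..} r *\<^sub>R ?f r)"
    by (rule integrable_cong_AE_imp[OF int _]) (use AE in \<open>auto elim: eventually_mono\<close>)
  have "(LBINT r=0..\<infinity>. ?f r) = 0 - 1"
  proof (rule interval_integral_FTC_integrable[where F = ?E])
    show "(?E has_vector_derivative ?f r) (at r)" for r :: real
    proof -
      have "((\<lambda>z. exp (- z\<^sup>2 - 2 * of_real s * z * cis (pi / 4))) has_field_derivative
          (- 2 * of_real r - 2 * of_real s * cis (pi / 4)) *
            exp (- (of_real r)\<^sup>2 - 2 * of_real s * of_real r * cis (pi / 4))) (at (of_real r))"
        by (rule derivative_eq_intros refl | simp)+
      then show ?thesis
        by (auto dest!: has_vector_derivative_real_field[of _ _ _ UNIV] simp: rotated_gaussian_def[abs_def])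
    qed
    show "isCont ?f r" for r :: real unfolding rotated_gaussian_def by (intro continuous_intros)
    show "set_integrable lborel (einterval 0 \<infinity>) ?f"
    proof -
      have "einterval 0 \<infinity> = {0<..}" by (auto simp: einterval_def)
      then show ?thesis using int' by (simp add: set_integrable_def)
    qed
    have "(?E \<longlongrightarrow> ?E 0) (at_right 0)"
      unfolding rotated_gaussian_def by (intro tendsto_intros)
    then show "((?E \<circ> real_of_ereal) \<longlongrightarrow> 1) (at_right 0)"
      by (simp add: ereal_tendsto_simps1 zero_ereal_def rotated_gaussian_def)
    have "(?E \<longlongrightarrow> 0) at_top"
    proof (rule Lim_null_comparison)
      show "\<forall>\<^sub>F r in at_top. norm (?E r) \<le> exp (- r)"
        using eventually_ge_at_top[of 1]
      proof eventually_elim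
        case (elim r)
        then have "r \<le> r\<^sup>2" "0 \<le> sqrt 2 * s * r" using assms by (auto simp: power2_eq_square)
        then show ?case by (simp add: norm_rotated_gaussian)
      qed
      show "((\<lambda>r::real. exp (- r)) \<longlongrightarrow> 0) at_top"
        by (intro filterlim_compose[OF exp_at_bot] filterlim_uminus_at_bot_at_top)
    qed
    then show "((?E \<circ> real_of_ereal) \<longlongrightarrow> 0) (at_left \<infinity>)"
      by (simp add: ereal_tendsto_simps1)
  qed simp
  then have "(LINT r|lborel. indicator {0<..} r *\<^sub>R ?f r) = - 1"
    using interval_lebesgue_integral_0_infty(2)[of lborel ?f]
    by (simp add: set_lebesgue_integral_def)
  then show ?thesis
    using integral_cong_AE[OF _ _ AE] int int' by auto
qed

text \<open>
  Differentiation produces the first moment of the rotated Gaussian, and the preceding identity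
  expresses this moment by the integral itself; here \<open>cis (pi / 4)\<close> squares to \<open>\<i>\<close>.
\<close>

lemma has_vector_derivative_fresnel_factor:
  assumes "0 \<le> s"
  shows "(fresnel_factor has_vector_derivative
           2 * of_real s * \<i> * fresnel_factor s - cis (pi / 4)) (at s within {0..})"
proof -
  let ?g = "\<lambda>s r. indicator {0..} r *\<^sub>R rotated_gaussian s r"
  let ?g' = "\<lambda>s r. indicator {0..} r *\<^sub>R ((- 2 * of_real r * cis (pi / 4)) * rotated_gaussian s r)"
  have int: "integrable lborel (?g s)" if "0 \<le> s" for s
    using integrable_fresnel[OF that, of 0] by simp
  have int': "integrable lborel (?g' s)"
  proof -
    have "integrable lborel (\<lambda>r. (- 2 * cis (pi / 4)) *
        (indicator {0..} r *\<^sub>R (of_real r ^ 1 * rotated_gaussian s r)))"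
      by (intro integrable_mult_right integrable_fresnel assms)
    then show ?thesis
      by (rule Bochner_Integration.integrable_cong[THEN iffD1, rotated 2])
         (auto simp: indicator_def algebra_simps)
  qed
  have "((\<lambda>s. LINT r|lborel. ?g s r) has_vector_derivative (LINT r|lborel. ?g' s r)) (at s within {0..})"
  proof (rule has_vector_derivative_LINT)
    show "integrable lborel (\<lambda>r::real. 2 * (indicator {0..} r *\<^sub>R (exp (- r\<^sup>2) * r)) :: real)"
    proof -
      have "integrable lborel (\<lambda>r::real. indicator {0..} r *\<^sub>R (exp (- r\<^sup>2) * r))"
        by (rule integrable.intros[OF gaussian_moment_1])
      then show ?thesis by (rule integrable_mult_right)
    qed
    show "((\<lambda>s. ?g s r) has_vector_derivative ?g' s r) (at s within {0..})" for s r
    proof -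
      have "((\<lambda>z. exp (- (of_real r)\<^sup>2 - 2 * z * of_real r * cis (pi / 4))) has_field_derivative
          (- 2 * of_real r * cis (pi / 4)) *
            exp (- (of_real r)\<^sup>2 - 2 * of_real s * of_real r * cis (pi / 4))) (at (of_real s))"
        by (rule derivative_eq_intros refl | simp)+
      then have "((\<lambda>s. rotated_gaussian s r) has_vector_derivative
          (- 2 * of_real r * cis (pi / 4)) * rotated_gaussian s r) (at s within {0..})"
        by (auto dest!: has_vector_derivative_real_field simp: rotated_gaussian_def)
      then show ?thesis
        by (auto simp: indicator_def)
    qed
    show "norm (?g' s r) \<le> 2 * (indicator {0..} r *\<^sub>R (exp (- r\<^sup>2) * r))" if "s \<in> {0..}" for s r
      using that by (auto simp: indicator_def norm_mult norm_rotated_gaussian mult.commute intro!: mult_left_mono)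
    show "?g' s \<in> borel_measurable lborel" by measurable
  qed (use assms int in auto)
  moreover have "(LINT r|lborel. ?g' s r) = 2 * of_real s * \<i> * fresnel_factor s - cis (pi / 4)"
  proof -
    let ?c = "cis (pi / 4)"
    have c2: "?c * ?c = \<i>" by (simp add: cis_mult)
    have "- ?c = (LINT r|lborel. ?c * (indicator {0..} r *\<^sub>R
        ((- 2 * of_real r - 2 * of_real s * ?c) * rotated_gaussian s r)))"
      unfolding integral_mult_right_zero using integral_derivative_fresnel[OF assms] by simp
    also have "\<dots> = (LINT r|lborel. ?g' s r - (2 * of_real s * (?c * ?c)) * ?g s r)"
      by (intro Bochner_Integration.integral_cong) (auto simp: indicator_def algebra_simps)
    also have "\<dots> = (LINT r|lborel. ?g' s r) - (LINT r|lborel. (2 * of_real s * (?c * ?c)) * ?g s r)"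
      by (intro Bochner_Integration.integral_diff int' integrable_mult_right int assms)
    also have "(LINT r|lborel. (2 * of_real s * (?c * ?c)) * ?g s r) =
        2 * of_real s * (?c * ?c) * fresnel_factor s"
      unfolding integral_mult_right_zero fresnel_factor_def ..
    finally show ?thesis by (simp add: c2 algebra_simps)
  qed
  ultimately show ?thesis by (simp add: fresnel_factor_def[abs_def])
qed

lemma has_vector_derivative_fresnel_tail:
  assumes "0 \<le> s"
  shows "(fresnel_tail has_vector_derivative - cis (- s\<^sup>2)) (at s within {0..})"
proof -
  have "((\<lambda>s. cis (- s\<^sup>2)) has_vector_derivative - (2 * of_real s * \<i>) * cis (- s\<^sup>2)) (at s within {0..})"
  proof -
    have "((\<lambda>z. exp (- (\<i> * z\<^sup>2))) has_field_derivative - (2 * of_real s * \<i>) * exp (- (\<i> * (of_real s)\<^sup>2))) (at (of_real s))"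
      by (rule derivative_eq_intros refl | simp)+
    then show ?thesis
      by (auto dest!: has_vector_derivative_real_field simp: cis_conv_exp)
  qed
  note mult = has_vector_derivative_mult[OF
      has_vector_derivative_mult[OF this has_vector_derivative_const[of "cis (- (pi / 4))"]]
      has_vector_derivative_fresnel_factor[OF assms]]
  let ?a = "cis (- s\<^sup>2)" and ?c = "cis (pi / 4)" and ?c' = "cis (- (pi / 4))"
    and ?h = "fresnel_factor s" and ?z = "complex_of_real s * \<i>"
  have "?a * ?c' * (2 * ?z * ?h - ?c) + (?a * 0 + - (2 * ?z) * ?a * ?c') * ?h = - ?a * (?c' * ?c)"
    by (simp only: algebra_simps mult_zero_right add_0_left) simp
  also have "\<dots> = - ?a" by (simp add: cis_mult)
  finally show ?thesis
    unfolding fresnel_tail_def[abs_def]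
    by (intro has_vector_derivative_eq_rhs[OF mult]) (simp only: mult.assoc)
qed

lemma fresnel_tail_0: "fresnel_tail 0 = of_real (sqrt pi / 2) * cis (- (pi / 4))"
  by (simp add: fresnel_tail_def fresnel_factor_0)

text \<open>
  Geometric interpolation between the bounds \<open>sqrt pi / 2\<close> and \<open>1 / (sqrt 2 s)\<close> with weights
  \<open>2 - 2 \<delta>\<close> and \<open>2 \<delta> - 1\<close>. The base of the power in \<open>L_const\<close> is larger than the quotient
  \<open>sqrt (2 / pi)\<close> that this produces.
\<close>

lemma norm_fresnel_tail_le:
  assumes s: "0 < s" and \<delta>: "1 / 2 \<le> \<delta>" "\<delta> \<le> 1"
  shows "norm (fresnel_tail s) \<le> L_const \<delta> * s powr (1 - 2 * \<delta>)"
proof (cases "fresnel_factor s = 0")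
  case True
  then show ?thesis by (simp add: fresnel_tail_def L_const_def)
next
  case False
  let ?x = "norm (fresnel_factor s)" and ?\<theta> = "2 * \<delta> - 1"
  let ?K = "1 / (2 * sqrt pi) + sqrt (1 / (4 * pi) + 1 / 2)"
  have K: "1 / (sqrt 2 * s) \<le> sqrt pi / 2 * (?K / s)"
  proof -
    \<comment> \<open>\<open>sqrt 2 \<le> 3 / 2 \<le> sqrt pi ?K\<close> suffices.\<close>
    have "sqrt pi * sqrt (1 / (4 * pi) + 1 / 2) = sqrt (1 / 4 + pi / 2)"
      by (simp flip: real_sqrt_mult add: algebra_simps)
    moreover have "1 \<le> sqrt (1 / 4 + pi / 2)"
      using pi_ge_two by (simp add: real_le_rsqrt)
    ultimately have "3 / 2 \<le> sqrt pi * ?K"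
      by (simp add: distrib_left)
    moreover have "sqrt 2 \<le> 3 / 2"
      by (rule real_le_lsqrt) (auto simp: power2_eq_square)
    then have "2 / sqrt 2 \<le> (3 / 2 :: real)"
      by (simp add: real_div_sqrt)
    ultimately have "2 / sqrt 2 \<le> sqrt pi * ?K" by linarith
    then have "2 / sqrt 2 / (2 * s) \<le> sqrt pi * ?K / (2 * s)"
      using s by (intro divide_right_mono) auto
    then show ?thesis by (simp add: mult_ac)
  qed
  have K0: "?K > 0" by (simp add: add_pos_pos)
  have "?x = ?x powr (1 - ?\<theta>) * ?x powr ?\<theta>"
    using False by (simp flip: powr_add)
  also have "\<dots> \<le> (sqrt pi / 2) powr (1 - ?\<theta>) * (sqrt pi / 2 * (?K / s)) powr ?\<theta>"
    using \<delta> s False norm_fresnel_factor_le[of s] norm_fresnel_factor_le_inverse[OF s] K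
    by (intro mult_mono powr_mono2) auto
  also have "(sqrt pi / 2 * (?K / s)) powr ?\<theta> = (sqrt pi / 2) powr ?\<theta> * (?K powr ?\<theta> / s powr ?\<theta>)"
    using s K0 by (subst powr_mult; simp only: powr_divide)
  also have "(sqrt pi / 2) powr (1 - ?\<theta>) * \<dots> =
      (sqrt pi / 2) powr (1 - ?\<theta> + ?\<theta>) * ?K powr ?\<theta> * s powr (- ?\<theta>)"
    by (simp only: powr_add powr_minus divide_inverse mult.assoc)
  also have "\<dots> = L_const \<delta> * s powr (1 - 2 * \<delta>)"
    by (simp add: L_const_def)
  finally show ?thesis by (simp add: fresnel_tail_def norm_mult)
qed

section \<open>Stationary phase on one side of the stationary point\<close>

text \<open>
  A phase on one side of a nondegenerate stationary point placed at 0, vanishing there together with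
  its derivative. The large parameter is absorbed in \<open>F\<close>, hence in \<open>m\<close>, \<open>M\<close> and \<open>T\<close>.
\<close>

locale quadratic_phase =
  fixes F F1 F2 F3 :: "real \<Rightarrow> real" and b m M T :: real
  assumes b: "0 \<le> b"
    and F_deriv: "\<And>x. x \<in> {0..b} \<Longrightarrow> (F has_real_derivative F1 x) (at x)"
    and F1_deriv: "\<And>x. x \<in> {0..b} \<Longrightarrow> (F1 has_real_derivative F2 x) (at x)"
    and F2_deriv: "\<And>x. x \<in> {0..b} \<Longrightarrow> (F2 has_real_derivative F3 x) (at x)"
    and F_0: "F 0 = 0" and F1_0: "F1 0 = 0"
    and m: "0 < m"
    and F2_bounds: "\<And>x. x \<in> {0..b} \<Longrightarrow> m \<le> F2 x \<and> F2 x \<le> M"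
    and F3_bound: "\<And>x. x \<in> {0..b} \<Longrightarrow> \<bar>F3 x\<bar> \<le> T"
begin

lemma M: "0 < M"
  using F2_bounds[of 0] b m by auto

lemma T: "0 \<le> T"
  using F3_bound[of 0] b by auto

lemma le_of_deriv_le:
  fixes g h g' h' :: "real \<Rightarrow> real"
  assumes "x \<in> {0..b}" "g 0 \<le> h 0"
    and "\<And>y. y \<in> {0..b} \<Longrightarrow> (g has_real_derivative g' y) (at y)"
    and "\<And>y. y \<in> {0..b} \<Longrightarrow> (h has_real_derivative h' y) (at y)"
    and "\<And>y. y \<in> {0..b} \<Longrightarrow> g' y \<le> h' y"
  shows "g x \<le> h x"
proof -
  have "(\<lambda>y. h y - g y) 0 \<le> (\<lambda>y. h y - g y) x"
  proof (rule DERIV_nonneg_imp_nondecreasing[where f = "\<lambda>y. h y - g y"])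
    fix y assume "0 \<le> y" "y \<le> x"
    then have "y \<in> {0..b}" using assms(1) by auto
    then show "\<exists>z. ((\<lambda>y. h y - g y) has_real_derivative z) (at y) \<and> 0 \<le> z"
      using DERIV_diff[OF assms(4,3)] assms(5)
      by (intro exI[of _ "h' y - g' y"]) simp
  qed (use assms in auto)
  then show ?thesis using assms(2) by simp
qed

lemma F1_bounds:
  assumes "x \<in> {0..b}"
  shows "m * x \<le> F1 x" "F1 x \<le> M * x"
proof -
  have lin: "((\<lambda>x. c * x) has_real_derivative c) (at x)" for c x :: real
    by (auto intro!: derivative_eq_intros)
  show "m * x \<le> F1 x"
    by (rule le_of_deriv_le[OF assms _ lin F1_deriv]) (use F1_0 F2_bounds in auto)
  show "F1 x \<le> M * x"
    by (rule le_of_deriv_le[OF assms _ F1_deriv lin]) (use F1_0 F2_bounds in auto)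
qed

lemma F_bounds:
  assumes "x \<in> {0..b}"
  shows "m * x\<^sup>2 / 2 \<le> F x" "F x \<le> M * x\<^sup>2 / 2"
proof -
  have quad: "((\<lambda>x. c * x\<^sup>2 / 2) has_real_derivative c * x) (at x)" for c x :: real
    by (auto intro!: derivative_eq_intros)
  show "m * x\<^sup>2 / 2 \<le> F x"
    by (rule le_of_deriv_le[OF assms _ quad F_deriv]) (use F_0 F1_bounds in auto)
  show "F x \<le> M * x\<^sup>2 / 2"
    by (rule le_of_deriv_le[OF assms _ F_deriv quad]) (use F_0 F1_bounds in auto)
qed

lemma F_pos: "F x > 0" and F1_pos: "F1 x > 0" if "x \<in> {0<..b}"
proof -
  have "0 < m * x\<^sup>2" "0 < m * x" using that m by auto
  then show "F x > 0" "F1 x > 0"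
    using that F_bounds(1)[of x] F1_bounds(1)[of x] by auto
qed

lemma F_nonneg: "F x \<ge> 0" if "x \<in> {0..b}"
  using that F_0 less_imp_le[OF F_pos[of x]] by (cases "x = 0") auto

text \<open>
  The expression vanishes for a purely quadratic phase. Its derivative is \<open>- 2 F F3\<close>, which is
  \<open>O(x\<^sup>2)\<close>, so it is \<open>O(x\<^sup>3)\<close>; this cubic order is what keeps the derivative of the Jacobian bounded
  at the stationary point.
\<close>

lemma quadratic_defect_bound:
  assumes "x \<in> {0..b}"
  shows "\<bar>(F1 x)\<^sup>2 - 2 * F x * F2 x\<bar> \<le> T * M * x ^ 3 / 3"
proof -
  let ?N = "\<lambda>x. (F1 x)\<^sup>2 - 2 * F x * F2 x"
  have N: "(?N has_real_derivative - 2 * F x * F3 x) (at x)" if "x \<in> {0..b}" for x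
    by (rule derivative_eq_intros F_deriv F1_deriv F2_deriv that refl)+ (simp add: algebra_simps)
  have B: "((\<lambda>x. T * M * x ^ 3 / 3) has_real_derivative T * M * x\<^sup>2) (at x)" for x
    by (auto intro!: derivative_eq_intros)
  have N': "\<bar>- 2 * F x * F3 x\<bar> \<le> T * M * x\<^sup>2" if x: "x \<in> {0..b}" for x
  proof -
    have F0: "0 \<le> F x" using x by (rule F_nonneg)
    have "2 * F x \<le> M * x\<^sup>2" using F_bounds(2)[OF x] by simp
    have "\<bar>- 2 * F x * F3 x\<bar> = (2 * F x) * \<bar>F3 x\<bar>"
      using F0 by (simp add: abs_mult)
    also have "\<dots> \<le> (M * x\<^sup>2) * T"
      using F3_bound[OF x] F0 T M by (intro mult_mono \<open>2 * F x \<le> M * x\<^sup>2\<close>) auto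
    finally show ?thesis by (simp add: mult_ac)
  qed
  have "?N x \<le> T * M * x ^ 3 / 3"
    by (rule le_of_deriv_le[where g = ?N and h = "\<lambda>x. T * M * x ^ 3 / 3", OF assms _ N B])
       (use N' F_0 F1_0 in \<open>auto simp: abs_le_iff\<close>)
  moreover have "- ?N x \<le> T * M * x ^ 3 / 3"
    by (rule le_of_deriv_le[where g = "\<lambda>x. - ?N x" and h = "\<lambda>x. T * M * x ^ 3 / 3",
          OF assms _ DERIV_minus[OF N] B])
       (use N' F_0 F1_0 in \<open>auto simp: abs_le_iff\<close>)
  ultimately show ?thesis by (intro abs_leI)
qed

text \<open>
  The Jacobian \<open>dx/d\<sigma>\<close> of the substitution \<open>\<sigma> = sqrt (F x)\<close>. At \<open>x = 0\<close> the formula gives the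
  default value 0 instead of the limit \<open>sqrt (2 / F2 0)\<close>.
\<close>

definition jacobian :: "real \<Rightarrow> real" where
  "jacobian x = 2 * sqrt (F x) / F1 x"

text \<open>
  The derivative of the Jacobian, with the quadratic defect in the numerator.
\<close>

definition jacobian' :: "real \<Rightarrow> real" where
  "jacobian' x = ((F1 x)\<^sup>2 - 2 * F x * F2 x) / (sqrt (F x) * (F1 x)\<^sup>2)"

lemma jacobian_deriv:
  assumes "x \<in> {0<..b}"
  shows "(jacobian has_real_derivative jacobian' x) (at x)"
proof -
  have x: "x \<in> {0..b}" using assms by auto
  note pos = F_pos[OF assms] F1_pos[OF assms]
  have "((\<lambda>x. sqrt (F x)) has_real_derivative inverse (sqrt (F x)) / 2 * F1 x) (at x)"
    using pos by (intro DERIV_chain2[OF DERIV_real_sqrt] F_deriv[OF x])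
  then have "(jacobian has_real_derivative
      (2 * (F1 x * (inverse (sqrt (F x)) / 2)) * F1 x - 2 * sqrt (F x) * F2 x) / (F1 x * F1 x)) (at x)"
    unfolding jacobian_def[abs_def] using pos
    by (intro DERIV_divide DERIV_cmult F1_deriv[OF x]) (auto simp: mult_ac)
  also have "(2 * (F1 x * (inverse (sqrt (F x)) / 2)) * F1 x - 2 * sqrt (F x) * F2 x) / (F1 x * F1 x) = jacobian' x"
  proof -
    have "sqrt (F x) * sqrt (F x) = F x" using pos by simp
    then have "(F1 x)\<^sup>2 - 2 * F x * F2 x = (F1 x)\<^sup>2 - 2 * (sqrt (F x) * sqrt (F x)) * F2 x" by simp
    then show ?thesis
      unfolding jacobian'_def using pos by (simp add: field_simps power2_eq_square)
  qed
  finally show ?thesis .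
qed

text \<open>
  The square of the Jacobian is \<open>(2 F F2 / F1\<^sup>2) (2 / F2)\<close>, and the defect bound forces the first
  factor to 1.
\<close>

lemma jacobian_tendsto:
  assumes "0 < b"
  shows "(jacobian \<longlongrightarrow> sqrt (2 / F2 0)) (at_right 0)"
proof -
  have ev: "\<forall>\<^sub>F x in at_right 0. x \<in> {0<..b}"
    using assms by (auto simp: eventually_at_right_field intro!: exI[of _ b])
  have lim: "((\<lambda>x. 2 * F x * F2 x / (F1 x)\<^sup>2) \<longlongrightarrow> 1) (at_right 0)"
  proof (rule Lim_transform[OF tendsto_const], rule Lim_null_comparison)
    show "\<forall>\<^sub>F x in at_right 0. norm (2 * F x * F2 x / (F1 x)\<^sup>2 - 1) \<le> T * M / (3 * m\<^sup>2) * x"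
      using ev
    proof eventually_elim
      case (elim x)
      then have x: "x \<in> {0..b}" "x > 0" by auto
      note pos = F_pos[OF elim] F1_pos[OF elim]
      have "2 * F x * F2 x / (F1 x)\<^sup>2 - 1 = - ((F1 x)\<^sup>2 - 2 * F x * F2 x) / (F1 x)\<^sup>2"
        using pos by (simp add: field_simps)
      also have "norm \<dots> = \<bar>(F1 x)\<^sup>2 - 2 * F x * F2 x\<bar> / (F1 x)\<^sup>2"
        by (simp add: abs_minus_commute)
      also have "\<dots> \<le> (T * M * x ^ 3 / 3) / (m * x)\<^sup>2"
        using x m M T F1_bounds(1)[OF x(1)]
        by (intro frac_le quadratic_defect_bound power_mono) auto
      also have "\<dots> = T * M / (3 * m\<^sup>2) * x"
        using x by (simp add: power2_eq_square power3_eq_cube)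
      finally show ?case .
    qed
    have "((\<lambda>x. T * M / (3 * m\<^sup>2) * x) \<longlongrightarrow> T * M / (3 * m\<^sup>2) * 0) (at_right 0)"
      by (intro tendsto_intros)
    then show "((\<lambda>x. T * M / (3 * m\<^sup>2) * x) \<longlongrightarrow> 0) (at_right 0)" by simp
  qed
  have F2: "(F2 \<longlongrightarrow> F2 0) (at_right 0)"
    using DERIV_isCont[OF F2_deriv[of 0]] assms
    by (auto simp: isCont_def intro: tendsto_within_subset)
  have F20: "F2 0 > 0" using F2_bounds[of 0] m assms by auto
  have "((\<lambda>x. sqrt (2 * F x * F2 x / (F1 x)\<^sup>2 * 2 / F2 x)) \<longlongrightarrow> sqrt (1 * 2 / F2 0)) (at_right 0)"
    by (intro tendsto_intros lim F2) (use F20 in simp)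
  moreover have "\<forall>\<^sub>F x in at_right 0. sqrt (2 * F x * F2 x / (F1 x)\<^sup>2 * 2 / F2 x) = jacobian x"
    using ev
  proof eventually_elim
    case (elim x)
    then have "F2 x > 0" using F2_bounds[of x] m by auto
    then have "2 * F x * F2 x / (F1 x)\<^sup>2 * 2 / F2 x = 4 * F x / (F1 x)\<^sup>2"
      by (simp add: field_simps)
    then show ?case
      using F1_pos[OF elim] by (simp add: jacobian_def real_sqrt_divide real_sqrt_mult)
  qed
  ultimately show ?thesis
    by (simp add: filterlim_cong)
qed

text \<open>
  Together the Jacobian and the tail give \<open>F^(1 - \<delta>) / F1\<close>, of order \<open>x^(2 - 2 \<delta>) / x\<close>.
\<close>

lemma jacobian_fresnel_bound:
  assumes x: "x \<in> {0<..b}" and \<delta>: "1 / 2 \<le> \<delta>" "\<delta> < 1"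
  shows "\<bar>jacobian x\<bar> * norm (fresnel_tail (sqrt (F x))) \<le>
           L_const \<delta> * (2 powr \<delta> * M powr (1 - \<delta>) / m) * x powr (1 - 2 * \<delta>)"
proof -
  have x': "x \<in> {0..b}" "x > 0" using x by auto
  note pos = F_pos[OF x] F1_pos[OF x]
  have L: "L_const \<delta> \<ge> 0" by (simp add: L_const_def)
  have "\<bar>jacobian x\<bar> * norm (fresnel_tail (sqrt (F x)))
      \<le> (2 * sqrt (F x) / F1 x) * (L_const \<delta> * sqrt (F x) powr (1 - 2 * \<delta>))"
    using pos \<delta> by (intro mult_mono norm_fresnel_tail_le) (auto simp: jacobian_def)
  also have "\<dots> = 2 * L_const \<delta> * (F x powr (1 - \<delta>) / F1 x)"
  proof -
    have "sqrt (F x) * sqrt (F x) powr (1 - 2 * \<delta>) = F x powr (1 / 2 + (1 - 2 * \<delta>) / 2)"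
      using pos by (simp only: powr_add) (simp add: powr_half_sqrt[symmetric] powr_powr)
    also have "1 / 2 + (1 - 2 * \<delta>) / 2 = 1 - \<delta>" by (simp add: field_simps)
    finally show ?thesis by (simp add: field_simps)
  qed
  also have "\<dots> \<le> 2 * L_const \<delta> * ((M * x\<^sup>2 / 2) powr (1 - \<delta>) / (m * x))"
    using pos \<delta> L m x' F_bounds(2)[OF x'(1)] F1_bounds(1)[OF x'(1)]
    by (intro mult_left_mono frac_le powr_mono2) auto
  also have "(M * x\<^sup>2 / 2) powr (1 - \<delta>) / (m * x) =
      2 powr \<delta> / 2 * M powr (1 - \<delta>) / m * x powr (1 - 2 * \<delta>)"
  proof -
    have 1: "(x\<^sup>2) powr (1 - \<delta>) = x powr (2 - 2 * \<delta>)"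
      using x' by (simp add: powr_powr flip: powr_numeral)
    have 2: "x powr (2 - 2 * \<delta>) / x = x powr (1 - 2 * \<delta>)"
    proof -
      have "1 - 2 * \<delta> = 2 - 2 * \<delta> - 1" by simp
      then have "x powr (1 - 2 * \<delta>) = x powr (2 - 2 * \<delta> - 1)" by (simp only:)
      also have "\<dots> = x powr (2 - 2 * \<delta>) / x" using x' by (subst powr_diff) simp
      finally show ?thesis ..
    qed
    have 3: "(1 / 2) powr (1 - \<delta>) = 2 powr \<delta> / (2 :: real)"
      by (simp add: powr_divide powr_diff)
    have 4: "(M * x\<^sup>2 / 2) powr (1 - \<delta>) = M powr (1 - \<delta>) * (x\<^sup>2) powr (1 - \<delta>) * (1 / 2) powr (1 - \<delta>)"
      using M x' by (simp add: powr_mult powr_divide)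
    have "(M * x\<^sup>2 / 2) powr (1 - \<delta>) / (m * x) =
        M powr (1 - \<delta>) * (x powr (2 - 2 * \<delta>) / x) * (2 powr \<delta> / 2) / m"
      unfolding 4 3 1 by simp
    then show ?thesis unfolding 2 by simp
  qed
  finally show ?thesis by (simp add: mult_ac)
qed

text \<open>
  Here the product is of order \<open>x\<^sup>3 F^(-\<delta>) / F1\<^sup>2\<close>, again of order \<open>x^(1 - 2 \<delta>)\<close>.
\<close>

lemma jacobian'_fresnel_bound:
  assumes x: "x \<in> {0<..b}" and \<delta>: "1 / 2 \<le> \<delta>" "\<delta> < 1"
  shows "\<bar>jacobian' x\<bar> * norm (fresnel_tail (sqrt (F x))) \<le>
           L_const \<delta> * (2 powr \<delta> * T * M * m powr (- 2 - \<delta>) / 3) * x powr (1 - 2 * \<delta>)"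
proof -
  have x': "x \<in> {0..b}" "x > 0" using x by auto
  note pos = F_pos[OF x] F1_pos[OF x]
  let ?N = "\<bar>(F1 x)\<^sup>2 - 2 * F x * F2 x\<bar>"
  have L: "L_const \<delta> \<ge> 0" by (simp add: L_const_def)
  have "\<bar>jacobian' x\<bar> * norm (fresnel_tail (sqrt (F x)))
      \<le> (?N / (sqrt (F x) * (F1 x)\<^sup>2)) * (L_const \<delta> * sqrt (F x) powr (1 - 2 * \<delta>))"
    using pos \<delta> by (intro mult_mono norm_fresnel_tail_le) (auto simp: jacobian'_def abs_mult)
  also have "\<dots> = L_const \<delta> * (?N * F x powr (- \<delta>) / (F1 x)\<^sup>2)"
  proof -
    have "sqrt (F x) powr (1 - 2 * \<delta>) / sqrt (F x) = sqrt (F x) powr (1 - 2 * \<delta> - 1)"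
      using pos by (subst (2) powr_diff) simp
    also have "\<dots> = F x powr (- \<delta>)"
      using pos by (simp add: powr_half_sqrt[symmetric] powr_powr)
    finally have "L_const \<delta> * ?N / (F1 x)\<^sup>2 * (sqrt (F x) powr (1 - 2 * \<delta>) / sqrt (F x)) =
        L_const \<delta> * ?N / (F1 x)\<^sup>2 * F x powr (- \<delta>)" by simp
    then show ?thesis by (simp add: mult_ac)
  qed
  also have "\<dots> \<le> L_const \<delta> * ((T * M * x ^ 3 / 3) * (m * x\<^sup>2 / 2) powr (- \<delta>) / (m * x)\<^sup>2)"
    using pos \<delta> L m M T x' F_bounds(1)[OF x'(1)] F1_bounds(1)[OF x'(1)]
    by (intro mult_left_mono frac_le mult_mono powr_mono2' quadratic_defect_bound power_mono) auto
  also have "(T * M * x ^ 3 / 3) * (m * x\<^sup>2 / 2) powr (- \<delta>) / (m * x)\<^sup>2 =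
      2 powr \<delta> * T * M * m powr (- 2 - \<delta>) / 3 * x powr (1 - 2 * \<delta>)"
  proof -
    have 1: "(x\<^sup>2) powr (- \<delta>) = x powr (- 2 * \<delta>)"
      using x' by (simp add: powr_powr flip: powr_numeral)
    have 2: "x ^ 3 / x\<^sup>2 = x"
      using x' by (simp add: power2_eq_square power3_eq_cube)
    have 3: "x * x powr (- 2 * \<delta>) = x powr (1 - 2 * \<delta>)"
      using x' powr_add[of x 1 "- 2 * \<delta>"] by simp
    have 4: "m powr (- \<delta>) / m\<^sup>2 = m powr (- 2 - \<delta>)"
    proof -
      have "- 2 - \<delta> = - \<delta> - 2" by simp
      moreover have "m powr (- \<delta> - 2) = m powr (- \<delta>) / m powr 2" by (rule powr_diff)
      moreover have "m powr 2 = m\<^sup>2" using m by (intro powr_numeral) simp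
      ultimately show ?thesis by metis
    qed
    have 5: "(m * x\<^sup>2 / 2) powr (- \<delta>) = m powr (- \<delta>) * (x\<^sup>2) powr (- \<delta>) * 2 powr \<delta>"
    proof -
      have "2 powr (- \<delta>) = 1 / (2 :: real) powr \<delta>" by (rule powr_minus_divide)
      then show ?thesis using m x' by (simp add: powr_mult powr_divide)
    qed
    have "(T * M * x ^ 3 / 3) * (m * x\<^sup>2 / 2) powr (- \<delta>) / (m * x)\<^sup>2 =
        2 powr \<delta> * T * M * (m powr (- \<delta>) / m\<^sup>2) / 3 * ((x ^ 3 / x\<^sup>2) * x powr (- 2 * \<delta>))"
      unfolding 5 1 power_mult_distrib by (simp add: mult_ac)
    then show ?thesis unfolding 2 3 4 .
  qed
  finally show ?thesis by (simp add: mult_ac)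
qed

text \<open>
  The primitive used in the integration by parts, extended to 0 by its limit.
\<close>

definition boundary_term :: "(real \<Rightarrow> complex) \<Rightarrow> real \<Rightarrow> complex" where
  "boundary_term U x = (if x = 0 then U 0 * of_real (sqrt (2 / F2 0)) * fresnel_tail 0
    else U x * of_real (jacobian x) * fresnel_tail (sqrt (F x)))"

text \<open>
  What is left of the derivative of \<open>boundary_term\<close> once the oscillating integrand is removed.
\<close>

definition remainder :: "(real \<Rightarrow> complex) \<Rightarrow> (real \<Rightarrow> complex) \<Rightarrow> real \<Rightarrow> complex" where
  "remainder U U' x = (U' x * of_real (jacobian x) + U x * of_real (jacobian' x)) *
    fresnel_tail (sqrt (F x))"

text \<open>
  The tail contributes \<open>- e^(-i F)\<close> times the derivative of \<open>sqrt F\<close>, and the latter cancels the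
  Jacobian.
\<close>

lemma boundary_term_deriv:
  assumes x: "x \<in> {0<..<b}"
    and U: "(U has_vector_derivative U' x) (at x)"
  shows "(boundary_term U has_vector_derivative remainder U U' x - U x * cis (- F x)) (at x)"
proof -
  have x0: "x \<in> {0..b}" "x \<in> {0<..b}" using x by auto
  note pos = F_pos[OF x0(2)] F1_pos[OF x0(2)]
  have "inverse (sqrt (F x)) / 2 * F1 x = F1 x / (2 * sqrt (F x))"
    using pos by (simp add: field_simps)
  then have s: "((\<lambda>x. sqrt (F x)) has_real_derivative F1 x / (2 * sqrt (F x))) (at x)"
    using DERIV_chain2[OF DERIV_real_sqrt[OF pos(1)] F_deriv[OF x0(1)]] by (simp only:)
  have "(fresnel_tail has_vector_derivative - cis (- (sqrt (F x))\<^sup>2)) (at (sqrt (F x)))"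
    using has_vector_derivative_fresnel_tail[of "sqrt (F x)"] pos at_within_interior[of "sqrt (F x)" "{0..}"]
    by simp
  moreover have "(sqrt (F x))\<^sup>2 = F x" using pos by simp
  ultimately have "(fresnel_tail has_vector_derivative - cis (- F x)) (at (sqrt (F x)))"
    by (simp only:)
  from vector_diff_chain_at[OF s[unfolded has_real_derivative_iff_has_vector_derivative] this]
  have Ft: "((\<lambda>x. fresnel_tail (sqrt (F x))) has_vector_derivative
      - (of_real (F1 x / (2 * sqrt (F x))) * cis (- F x))) (at x)"
    unfolding o_def scaleR_conv_of_real mult_minus_right .
  have J: "((\<lambda>x. complex_of_real (jacobian x)) has_vector_derivative of_real (jacobian' x)) (at x)"
    by (rule has_vector_derivative_of_real[OF jacobian_deriv[OF x0(2)]])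
  have "jacobian x * (F1 x / (2 * sqrt (F x))) = 1"
    using pos by (simp add: jacobian_def)
  then have J1: "complex_of_real (jacobian x) * of_real (F1 x / (2 * sqrt (F x))) = 1"
    by (metis of_real_1 of_real_mult)
  have alg: "(u * j) * - (a * c) + (u * j' + u' * j) * t = (u' * j + u * j') * t - u * c"
    if "j * a = 1" for u u' j j' a c t :: complex
  proof -
    have "(u * j) * - (a * c) = - ((j * a) * (u * c))" by (simp add: mult_ac)
    then show ?thesis unfolding that by (simp add: distrib_right)
  qed
  have "((\<lambda>x. U x * of_real (jacobian x) * fresnel_tail (sqrt (F x))) has_vector_derivative
      remainder U U' x - U x * cis (- F x)) (at x)"
    unfolding remainder_def
    by (rule has_vector_derivative_eq_rhs[OF
        has_vector_derivative_mult[OF has_vector_derivative_mult[OF U J] Ft] alg[OF J1]])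
  then show ?thesis
    by (rule has_vector_derivative_transform_within_open[of _ _ _ "{0<..<b}"])
       (use x in \<open>auto simp: boundary_term_def\<close>)
qed

lemma boundary_term_continuous:
  assumes U: "continuous_on {0..b} U"
  shows "continuous_on {0..b} (boundary_term U)"
  unfolding continuous_on_eq_continuous_within
proof
  fix x assume x: "x \<in> {0..b}"
  have Ux: "continuous (at x within {0..b}) U"
    using U x by (simp add: continuous_on_eq_continuous_within)
  have Fx: "continuous (at x within {0..b}) (\<lambda>x. sqrt (F x))"
    by (rule continuous_real_sqrt[OF continuous_at_imp_continuous_at_within[OF DERIV_isCont[OF F_deriv[OF x]]]])
  have "continuous (at (sqrt (F x)) within {0..}) fresnel_tail"
    using F_nonneg[OF x]
    by (intro has_vector_derivative_continuous[OF has_vector_derivative_fresnel_tail]) simp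
  then have "continuous (at (sqrt (F x)) within (\<lambda>x. sqrt (F x)) ` {0..b}) fresnel_tail"
    by (rule continuous_within_subset) (use F_nonneg in auto)
  with Fx have Ft: "continuous (at x within {0..b}) (\<lambda>x. fresnel_tail (sqrt (F x)))"
    by (rule continuous_within_compose2)
  show "continuous (at x within {0..b}) (boundary_term U)"
  proof (cases "x = 0")
    case True
    show ?thesis
    proof (cases "b = 0")
      case False
      then have b0: "0 < b" using b by simp
      have "at 0 within {0..b} = at_right (0 :: real)"
        using b0 by (rule at_within_Icc_at_right)
      note lims = Ux[unfolded True continuous_within this] Ft[unfolded True continuous_within this]
        jacobian_tendsto[OF b0]
      have "((\<lambda>x. U x * of_real (jacobian x) * fresnel_tail (sqrt (F x))) \<longlongrightarrow>
          U 0 * of_real (sqrt (2 / F2 0)) * fresnel_tail (sqrt (F 0))) (at_right 0)"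
        by (intro tendsto_mult tendsto_of_real lims)
      moreover have "\<forall>\<^sub>F x in at_right 0.
          U x * of_real (jacobian x) * fresnel_tail (sqrt (F x)) = boundary_term U x"
        unfolding eventually_at_filter by (intro always_eventually) (simp add: boundary_term_def)
      ultimately have "(boundary_term U \<longlongrightarrow>
          U 0 * of_real (sqrt (2 / F2 0)) * fresnel_tail (sqrt (F 0))) (at_right 0)"
        by (rule Lim_transform_eventually)
      moreover have "U 0 * of_real (sqrt (2 / F2 0)) * fresnel_tail (sqrt (F 0)) = boundary_term U 0"
        by (simp add: boundary_term_def F_0)
      ultimately have "(boundary_term U \<longlongrightarrow> boundary_term U 0) (at_right 0)"
        by (simp only:)
      then show ?thesis
        unfolding True continuous_within \<open>at 0 within {0..b} = at_right 0\<close> .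
    next
      case b0: True
      show ?thesis
        unfolding True b0 atLeastAtMost_singleton continuous_within
        by (simp add: at_within_def)
    qed
  next
    case False
    then have x0: "x \<in> {0<..b}" using x by auto
    have "continuous (at x within {0..b}) (\<lambda>x. U x * of_real (jacobian x) * fresnel_tail (sqrt (F x)))"
      by (intro continuous_mult continuous_of_real Ux Ft
          continuous_at_imp_continuous_at_within[OF DERIV_isCont[OF jacobian_deriv[OF x0]]])
    then show ?thesis
      by (rule continuous_transform_within[of _ _ _ x])
         (use x0 in \<open>auto simp: boundary_term_def dist_real_def\<close>)
  qed
qed

text \<open>
  The product of \<open>|U'|\<close> and \<open>x^(1 - 2 \<delta>)\<close> is split by the weighted inequality between arithmetic and
  geometric means. With the weight \<open>l\<close> left free this amounts to the Cauchy-Schwarz inequality,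
  but it stays additive, so that the two sides of the stationary point can be summed before \<open>l\<close> is
  optimised.
\<close>

lemma remainder_bound:
  assumes x: "x \<in> {0..b}" and \<delta>: "1 / 2 < \<delta>" "\<delta> < 3 / 4" and l: "0 < l"
    and K: "norm (U x) \<le> K"
  defines "c1 \<equiv> 2 powr \<delta> * M powr (1 - \<delta>) / m"
    and "c2 \<equiv> 2 powr \<delta> * T * M * m powr (- 2 - \<delta>) / 3"
  shows "norm (remainder U U' x) \<le> L_const \<delta> *
    (c1 * (l / 2 * (norm (U' x))\<^sup>2 + x powr (2 - 4 * \<delta>) / (2 * l)) + c2 * K * x powr (1 - 2 * \<delta>))"
proof -
  have c: "0 \<le> c1" "0 \<le> c2" using m M T by (auto simp: c1_def c2_def)
  have L: "0 \<le> L_const \<delta>" by (simp add: L_const_def)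
  have K0: "0 \<le> K" using order_trans[OF norm_ge_zero K] .
  show ?thesis
  proof (cases "x = 0")
    case True
    then show ?thesis using c L K0 l by (simp add: remainder_def jacobian_def jacobian'_def F_0)
  next
    case False
    then have x0: "x \<in> {0<..b}" "x > 0" using x by auto
    let ?w = "x powr (1 - 2 * \<delta>)" and ?n = "norm (fresnel_tail (sqrt (F x)))"
    have amgm: "norm (U' x) * ?w \<le> l / 2 * (norm (U' x))\<^sup>2 + x powr (2 - 4 * \<delta>) / (2 * l)"
    proof -
      have w2: "x powr (2 - 4 * \<delta>) = ?w\<^sup>2"
        using x0 by (simp add: power2_eq_square flip: powr_add)
      have "0 \<le> (l * norm (U' x) - ?w)\<^sup>2 / (2 * l)" using l by simp
      also have "\<dots> = l / 2 * (norm (U' x))\<^sup>2 + ?w\<^sup>2 / (2 * l) - norm (U' x) * ?w"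
        using l by (simp add: field_simps power2_eq_square)
      finally show ?thesis unfolding w2 by simp
    qed
    have \<delta>': "1 / 2 \<le> \<delta>" "\<delta> < 1" using \<delta> by auto
    note J = jacobian_fresnel_bound[OF x0(1) \<delta>', folded c1_def]
      jacobian'_fresnel_bound[OF x0(1) \<delta>', folded c2_def]
    have "norm (remainder U U' x) \<le> (norm (U' x) * \<bar>jacobian x\<bar> + norm (U x) * \<bar>jacobian' x\<bar>) * ?n"
      unfolding remainder_def norm_mult
      by (intro mult_right_mono order_trans[OF norm_triangle_ineq]) (simp_all add: norm_mult)
    also have "\<dots> = norm (U' x) * (\<bar>jacobian x\<bar> * ?n) + norm (U x) * (\<bar>jacobian' x\<bar> * ?n)"
      by (simp only: distrib_right mult.assoc)
    also have "\<dots> \<le> norm (U' x) * (L_const \<delta> * c1 * ?w) + K * (L_const \<delta> * c2 * ?w)"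
      by (intro add_mono mult_mono J K K0 order_refl mult_nonneg_nonneg norm_ge_zero abs_ge_zero)
    also have "\<dots> = L_const \<delta> * (c1 * (norm (U' x) * ?w) + c2 * K * ?w)"
      by (simp only: distrib_left mult_ac)
    also have "\<dots> \<le> L_const \<delta> * (c1 * (l / 2 * (norm (U' x))\<^sup>2 + x powr (2 - 4 * \<delta>) / (2 * l)) + c2 * K * ?w)"
      by (intro mult_left_mono add_mono amgm c L order_refl)
    finally show ?thesis .
  qed
qed

lemma one_sided_expansion:
  fixes U U' :: "real \<Rightarrow> complex"
  assumes U: "\<And>x. x \<in> {0..b} \<Longrightarrow> (U has_vector_derivative U' x) (at x)"
    and U': "continuous_on {0..b} U'"
    and Ub: "U b = 0" and K: "\<And>x. x \<in> {0..b} \<Longrightarrow> norm (U x) \<le> K"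
    and \<delta>: "1 / 2 < \<delta>" "\<delta> < 3 / 4" and l: "0 < l"
  shows "norm (integral {0..b} (\<lambda>x. U x * cis (- F x))
           - U 0 * of_real (sqrt (2 / F2 0)) * (of_real (sqrt pi / 2) * cis (- (pi / 4))))
    \<le> L_const \<delta> * (2 powr \<delta> * M powr (1 - \<delta>) / m *
          (l / 2 * integral {0..b} (\<lambda>x. (norm (U' x))\<^sup>2) + b powr (3 - 4 * \<delta>) / (3 - 4 * \<delta>) / (2 * l))
        + 2 powr \<delta> * T * M * m powr (- 2 - \<delta>) / 3 * K * (b powr (2 - 2 * \<delta>) / (2 - 2 * \<delta>)))"
    (is "norm (?I - ?main) \<le> ?bound")
proof -
  let ?H = "boundary_term U" and ?R = "remainder U U'"
  have Ucont: "continuous_on {0..b} U"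
    using U by (meson continuous_at_imp_continuous_on has_vector_derivative_continuous)
  have Fcont: "continuous_on {0..b} F"
    using F_deriv by (meson continuous_at_imp_continuous_on DERIV_isCont)
  have HI: "((\<lambda>x. ?R x - U x * cis (- F x)) has_integral (?H b - ?H 0)) {0..b}"
    by (rule fundamental_theorem_of_calculus_interior[OF b boundary_term_continuous[OF Ucont]])
       (auto intro!: boundary_term_deriv U)
  have "continuous_on {0..b} (\<lambda>x. U x * cis (- F x))"
    by (intro continuous_on_mult Ucont continuous_on_cis continuous_on_minus Fcont)
  then have UI: "(\<lambda>x. U x * cis (- F x)) integrable_on {0..b}"
    by (rule integrable_continuous_interval)
  have RI: "(?R has_integral (?H b - ?H 0 + ?I)) {0..b}"
    using has_integral_add[OF HI integrable_integral[OF UI]] by simp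
  have H_b: "?H b = 0" using Ub by (auto simp: boundary_term_def)
  have H_0: "?H 0 = ?main" by (simp add: boundary_term_def fresnel_tail_0)
  define c1 c2 where "c1 = 2 powr \<delta> * M powr (1 - \<delta>) / m"
    and "c2 = 2 powr \<delta> * T * M * m powr (- 2 - \<delta>) / 3"
  define B where "B x = L_const \<delta> * (c1 * (l / 2 * (norm (U' x))\<^sup>2 + x powr (2 - 4 * \<delta>) / (2 * l)) +
      c2 * K * x powr (1 - 2 * \<delta>))" for x
  have RB: "norm (?R x) \<le> B x" if x: "x \<in> {0..b}" for x
    unfolding B_def c1_def c2_def by (rule remainder_bound[where U = U, OF x \<delta> l K[OF x]])
  have BI: "(B has_integral ?bound) {0..b}"
  proof -
    have "continuous_on {0..b} (\<lambda>x. (norm (U' x))\<^sup>2)"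
      by (intro continuous_on_power continuous_on_norm U')
    then have 1: "((\<lambda>x. (norm (U' x))\<^sup>2) has_integral integral {0..b} (\<lambda>x. (norm (U' x))\<^sup>2)) {0..b}"
      by (intro integrable_integral integrable_continuous_interval)
    have 2: "((\<lambda>x. x powr (2 - 4 * \<delta>)) has_integral (b powr (3 - 4 * \<delta>) / (3 - 4 * \<delta>))) {0..b}"
    proof -
      have e: "2 - 4 * \<delta> + 1 = 3 - 4 * \<delta>" by simp
      show ?thesis
        using has_integral_powr_from_0[of "2 - 4 * \<delta>" b] \<delta> b unfolding e by simp
    qed
    have 3: "((\<lambda>x. x powr (1 - 2 * \<delta>)) has_integral (b powr (2 - 2 * \<delta>) / (2 - 2 * \<delta>))) {0..b}"
    proof -
      have e: "1 - 2 * \<delta> + 1 = 2 - 2 * \<delta>" by simp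
      show ?thesis
        using has_integral_powr_from_0[of "1 - 2 * \<delta>" b] \<delta> b unfolding e by simp
    qed
    show ?thesis
      unfolding B_def c1_def[symmetric] c2_def[symmetric]
      by (intro has_integral_mult_right has_integral_add has_integral_divide 1 2 3)
  qed
  have "norm (integral {0..b} ?R) \<le> integral {0..b} B"
    by (rule Henstock_Kurzweil_Integration.integral_norm_bound_integral)
       (use RI BI RB in \<open>auto simp: has_integral_iff\<close>)
  moreover have "integral {0..b} ?R = ?I - ?main"
    using RI by (simp add: has_integral_iff H_b H_0)
  moreover have "integral {0..b} B = ?bound"
    using BI by (rule integral_unique)
  ultimately show ?thesis by simp
qed

end

section \<open>Stationary phase on both sides\<close>

text \<open>
  Optimising the weight: \<open>l = sqrt (B / A)\<close>. This recovers the Cauchy-Schwarz inequality from the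
  weighted means.
\<close>

lemma le_sqrt_mult_if_le_weighted_mean:
  fixes X A B :: real
  assumes X: "\<And>l. 0 < l \<Longrightarrow> X \<le> l / 2 * A + B / (2 * l)" and "0 \<le> A" "0 \<le> B"
  shows "X \<le> sqrt (A * B)"
proof (cases "0 < X")
  case pos: True
  have A: "A \<noteq> 0"
  proof
    assume "A = 0"
    with X[of 1] pos have "B > 0" by simp
    with X[of "B / X"] pos \<open>A = 0\<close> show False by simp
  qed
  have B: "B \<noteq> 0"
  proof
    assume "B = 0"
    with X[of "X / A"] pos A \<open>0 \<le> A\<close> show False by simp
  qed
  have "0 < sqrt A" "0 < sqrt B" using A B assms(2,3) by auto
  moreover have "sqrt A * sqrt A = A" "sqrt B * sqrt B = B" using assms(2,3) by auto
  ultimately have "sqrt B / sqrt A / 2 * A + B / (2 * (sqrt B / sqrt A)) = sqrt A * sqrt B"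
    by (simp add: field_simps)
  with X[of "sqrt B / sqrt A"] \<open>0 < sqrt A\<close> \<open>0 < sqrt B\<close> show ?thesis
    by (simp add: real_sqrt_mult)
next
  case False
  moreover have "0 \<le> sqrt (A * B)" using assms(2,3) by simp
  ultimately show ?thesis by linarith
qed

lemma integral_split_at:
  fixes g :: "real \<Rightarrow> 'a::euclidean_space"
  assumes g: "continuous_on {a..b} g" and c: "c \<in> {a..b}"
  shows "integral {a..b} g =
    integral {0..b - c} (\<lambda>h. g (c + 1 * h)) + integral {0..c - a} (\<lambda>h. g (c + - 1 * h))"
proof -
  have "integral {0..b - c} (\<lambda>h. g (c + 1 * h)) = integral {c..b} g"
    using integral_shift_real_ivl[of c c b g] by (simp add: add.commute)
  moreover have "integral {0..c - a} (\<lambda>h. g (c + - 1 * h)) = integral {a - c..0} (\<lambda>x. g (x + c))"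
    using Henstock_Kurzweil_Integration.integral_reflect_real[of 0 "a - c" "\<lambda>x. g (x + c)"] by (simp add: add.commute)
  moreover have "integral {a - c..0} (\<lambda>x. g (x + c)) = integral {a..c} g"
    using integral_shift_real_ivl[of a c c g] by simp
  moreover have "integral {a..c} g + integral {c..b} g = integral {a..b} g"
    using c by (intro Henstock_Kurzweil_Integration.integral_combine integrable_continuous_interval g) auto
  ultimately show ?thesis by (simp add: add.commute)
qed

text \<open>
  The stationary point is created by subtracting a tangent from \<open>f\<close>, so that one phase serves every
  point of the interval, the end points included.
\<close>

locale convex_phase =
  fixes f f1 f2 f3 :: "real \<Rightarrow> real" and q1 q2 m M T :: real
  assumes f_deriv: "\<And>p. p \<in> {q1..q2} \<Longrightarrow> (f has_real_derivative f1 p) (at p)"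
    and f1_deriv: "\<And>p. p \<in> {q1..q2} \<Longrightarrow> (f1 has_real_derivative f2 p) (at p)"
    and f2_deriv: "\<And>p. p \<in> {q1..q2} \<Longrightarrow> (f2 has_real_derivative f3 p) (at p)"
    and m: "0 < m"
    and f2_bounds: "\<And>p. p \<in> {q1..q2} \<Longrightarrow> m \<le> f2 p \<and> f2 p \<le> M"
    and f3_bound: "\<And>p. p \<in> {q1..q2} \<Longrightarrow> \<bar>f3 p\<bar> \<le> T"
begin

lemma scaled_convex_phase:
  assumes "0 < t"
  shows "convex_phase (\<lambda>p. t * f p) (\<lambda>p. t * f1 p) (\<lambda>p. t * f2 p) (\<lambda>p. t * f3 p) q1 q2 (t * m) (t * M) (t * T)"
  by unfold_locales
     (use assms m f2_bounds f3_bound in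
       \<open>auto intro!: DERIV_cmult f_deriv f1_deriv f2_deriv mult_left_mono simp: abs_mult\<close>)

text \<open>
  The sign \<open>\<sigma>\<close> selects the side of \<open>p0\<close>; on the left the phase is reflected.
\<close>

lemma one_side_quadratic_phase:
  assumes \<sigma>: "\<sigma> = 1 \<or> \<sigma> = -1" and b: "0 \<le> b"
    and side: "\<And>h. h \<in> {0..b} \<Longrightarrow> p0 + \<sigma> * h \<in> {q1..q2}"
  shows "quadratic_phase (\<lambda>h. f (p0 + \<sigma> * h) - f p0 - f1 p0 * (\<sigma> * h)) (\<lambda>h. \<sigma> * (f1 (p0 + \<sigma> * h) - f1 p0))
    (\<lambda>h. f2 (p0 + \<sigma> * h)) (\<lambda>h. \<sigma> * f3 (p0 + \<sigma> * h)) b m M T"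
proof -
  have lin: "((\<lambda>h. p0 + \<sigma> * h) has_real_derivative \<sigma>) (at h)" for h
    by (auto intro!: derivative_eq_intros)
  have ss: "\<sigma> * \<sigma> = 1" "\<bar>\<sigma>\<bar> = 1" using \<sigma> by auto
  show ?thesis
  proof
    fix h assume h: "h \<in> {0..b}"
    note chain = DERIV_chain2[OF f_deriv[OF side[OF h]] lin] DERIV_chain2[OF f1_deriv[OF side[OF h]] lin]
      DERIV_chain2[OF f2_deriv[OF side[OF h]] lin]
    show "((\<lambda>h. f (p0 + \<sigma> * h) - f p0 - f1 p0 * (\<sigma> * h)) has_real_derivative
        \<sigma> * (f1 (p0 + \<sigma> * h) - f1 p0)) (at h)"
      by (rule chain derivative_eq_intros refl)+ (simp add: algebra_simps)
    show "((\<lambda>h. \<sigma> * (f1 (p0 + \<sigma> * h) - f1 p0)) has_real_derivative f2 (p0 + \<sigma> * h)) (at h)"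
      by (rule chain derivative_eq_intros refl)+ (simp add: ss mult.left_commute[of \<sigma>])
    show "((\<lambda>h. f2 (p0 + \<sigma> * h)) has_real_derivative \<sigma> * f3 (p0 + \<sigma> * h)) (at h)"
      using chain(3) by (simp add: mult.commute)
  qed (use b m f2_bounds[OF side] f3_bound[OF side] in \<open>auto simp: abs_mult ss\<close>)
qed

text \<open>
  Each side contributes half of the leading term, also when \<open>p0\<close> is an end point: then one of the two
  intervals is a point, and the half that it should contribute vanishes with \<open>U\<close>. The weight \<open>l\<close> is
  optimised after both sides have been added, which yields the energy on the whole interval.
\<close>

lemma stationary_phase_expansion:
  fixes U U' :: "real \<Rightarrow> complex"
  assumes p0: "p0 \<in> {q1..q2}"
    and U: "\<And>p. p \<in> {q1..q2} \<Longrightarrow> (U has_vector_derivative U' p) (at p)"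
    and U': "continuous_on {q1..q2} U'"
    and Uq: "U q1 = 0" "U q2 = 0" and K: "\<And>p. p \<in> {q1..q2} \<Longrightarrow> norm (U p) \<le> K"
    and \<delta>: "1 / 2 < \<delta>" "\<delta> < 3 / 4"
  shows "norm (integral {q1..q2} (\<lambda>p. U p * cis (- (f p - f p0 - f1 p0 * (p - p0))))
           - U p0 * of_real (sqrt (2 * pi / f2 p0)) * cis (- (pi / 4)))
    \<le> L_const \<delta> * (2 powr \<delta> * M powr (1 - \<delta>) / m *
          sqrt (integral {q1..q2} (\<lambda>p. (norm (U' p))\<^sup>2) * (2 * (q2 - q1) powr (3 - 4 * \<delta>) / (3 - 4 * \<delta>)))
        + 2 powr \<delta> * T * M * m powr (- 2 - \<delta>) / 3 * K * ((q2 - q1) powr (2 - 2 * \<delta>) / (1 - \<delta>)))"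
    (is "norm (?I - ?main) \<le> L_const \<delta> * (?c1 * sqrt (?E * ?B) + ?c2 * K * ?D)")
proof -
  let ?J = "\<lambda>\<sigma> b. integral {0..b} (\<lambda>h. U (p0 + \<sigma> * h) * cis (- (f (p0 + \<sigma> * h) - f p0 - f1 p0 * (\<sigma> * h))))"
  let ?e = "\<lambda>\<sigma> b. integral {0..b} (\<lambda>h. (norm (U' (p0 + \<sigma> * h)))\<^sup>2)"
  let ?half = "U p0 * of_real (sqrt (2 / f2 p0)) * (of_real (sqrt pi / 2) * cis (- (pi / 4)))"
  have q: "q1 \<le> q2" using p0 by auto
  have M0: "0 < M" using f2_bounds[OF p0] m by linarith
  have T0: "0 \<le> T" using f3_bound[OF p0] by linarith
  have K0: "0 \<le> K" using order_trans[OF norm_ge_zero K[OF p0]] .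
  have "0 < 1 / (2 * sqrt pi) + sqrt (1 / (4 * pi) + 1 / 2)" by (simp add: add_pos_pos)
  then have L: "0 < L_const \<delta>" unfolding L_const_def by simp
  have c: "0 < ?c1" "0 \<le> ?c2" using m M0 T0 by auto
  have side: "norm (?J \<sigma> b - ?half) \<le> L_const \<delta> * (?c1 * (l / 2 * ?e \<sigma> b + ?B / 2 / (2 * l)) + ?c2 * K * (?D / 2))"
    if \<sigma>: "\<sigma> = 1 \<or> \<sigma> = - 1" and b: "0 \<le> b" and s: "\<And>h. h \<in> {0..b} \<Longrightarrow> p0 + \<sigma> * h \<in> {q1..q2}"
      and end0: "U (p0 + \<sigma> * b) = 0" and l: "0 < l" for \<sigma> b l
  proof -
    interpret quadratic_phase "\<lambda>h. f (p0 + \<sigma> * h) - f p0 - f1 p0 * (\<sigma> * h)" "\<lambda>h. \<sigma> * (f1 (p0 + \<sigma> * h) - f1 p0)"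
      "\<lambda>h. f2 (p0 + \<sigma> * h)" "\<lambda>h. \<sigma> * f3 (p0 + \<sigma> * h)" b m M T
      by (rule one_side_quadratic_phase[OF \<sigma> b s])
    have lin: "((\<lambda>h. p0 + \<sigma> * h) has_vector_derivative \<sigma>) (at h)" for h
      by (auto intro!: derivative_eq_intros)
    have "norm (?J \<sigma> b - ?half) \<le> L_const \<delta> * (?c1 * (l / 2 * integral {0..b} (\<lambda>h. (norm (\<sigma> *\<^sub>R U' (p0 + \<sigma> * h)))\<^sup>2)
        + b powr (3 - 4 * \<delta>) / (3 - 4 * \<delta>) / (2 * l)) + ?c2 * K * (b powr (2 - 2 * \<delta>) / (2 - 2 * \<delta>)))"
    proof -
      have 1: "((\<lambda>h. U (p0 + \<sigma> * h)) has_vector_derivative \<sigma> *\<^sub>R U' (p0 + \<sigma> * h)) (at h)"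
        if "h \<in> {0..b}" for h
        using vector_diff_chain_at[OF lin U[OF s[OF that]]] by (simp only: o_def)
      have 2: "continuous_on {0..b} (\<lambda>h. \<sigma> *\<^sub>R U' (p0 + \<sigma> * h))"
        by (intro continuous_on_scaleR continuous_on_const continuous_on_compose2[OF U'] continuous_intros)
           (use s in auto)
      show ?thesis
        using one_sided_expansion[of "\<lambda>h. U (p0 + \<sigma> * h)", OF 1 2 end0 K[OF s] \<delta> l]
        by (simp only: mult_zero_right add_0_right)
    qed
    also have "integral {0..b} (\<lambda>h. (norm (\<sigma> *\<^sub>R U' (p0 + \<sigma> * h)))\<^sup>2) = ?e \<sigma> b"
      using \<sigma> by (auto simp: norm_mult)
    also have "L_const \<delta> * (?c1 * (l / 2 * ?e \<sigma> b
        + b powr (3 - 4 * \<delta>) / (3 - 4 * \<delta>) / (2 * l)) + ?c2 * K * (b powr (2 - 2 * \<delta>) / (2 - 2 * \<delta>)))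
      \<le> L_const \<delta> * (?c1 * (l / 2 * ?e \<sigma> b + ?B / 2 / (2 * l)) + ?c2 * K * (?D / 2))"
    proof -
      have "b \<le> q2 - q1" using s[of 0] s[of b] b \<sigma> by auto
      then have "b powr (3 - 4 * \<delta>) \<le> (q2 - q1) powr (3 - 4 * \<delta>)" "b powr (2 - 2 * \<delta>) \<le> (q2 - q1) powr (2 - 2 * \<delta>)"
        using b \<delta> by (auto intro!: powr_mono2)
      moreover have "?B / 2 = (q2 - q1) powr (3 - 4 * \<delta>) / (3 - 4 * \<delta>)"
        "?D / 2 = (q2 - q1) powr (2 - 2 * \<delta>) / (2 - 2 * \<delta>)"
        using \<delta> by (auto simp: field_simps)
      ultimately have "b powr (3 - 4 * \<delta>) / (3 - 4 * \<delta>) \<le> ?B / 2" "b powr (2 - 2 * \<delta>) / (2 - 2 * \<delta>) \<le> ?D / 2"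
        using \<delta> by (simp_all only:) (auto intro!: divide_right_mono)
      then show ?thesis
        using L c K0 l by (intro mult_left_mono add_mono divide_right_mono order_refl) auto
    qed
    finally show ?thesis .
  qed
  have fcont: "continuous_on {q1..q2} f"
    using f_deriv by (meson continuous_at_imp_continuous_on DERIV_isCont)
  have Ucont: "continuous_on {q1..q2} U"
    using U by (meson continuous_at_imp_continuous_on has_vector_derivative_continuous)
  have I: "?I = ?J 1 (q2 - p0) + ?J (- 1) (p0 - q1)"
    by (subst integral_split_at[OF _ p0]) (auto intro!: continuous_on_mult continuous_on_cis
        continuous_on_minus continuous_on_diff continuous_intros Ucont fcont)
  have E: "?E = ?e 1 (q2 - p0) + ?e (- 1) (p0 - q1)"
    by (subst integral_split_at[OF _ p0]) (auto intro!: continuous_on_power continuous_on_norm U')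
  have main: "?main = ?half + ?half"
  proof -
    have "sqrt (2 * pi / f2 p0) = sqrt (2 / f2 p0) * (sqrt pi / 2) + sqrt (2 / f2 p0) * (sqrt pi / 2)"
      by (simp add: real_sqrt_mult real_sqrt_divide)
    then show ?thesis by (simp add: algebra_simps flip: of_real_add of_real_mult)
  qed
  have N: "norm (?I - ?main) \<le> L_const \<delta> * (?c1 * (l / 2 * ?E + ?B / (2 * l)) + ?c2 * K * ?D)" if l: "0 < l" for l
  proof -
    have "norm (?I - ?main) = norm ((?J 1 (q2 - p0) - ?half) + (?J (- 1) (p0 - q1) - ?half))"
      unfolding I main by (simp add: algebra_simps)
    also have "\<dots> \<le> norm (?J 1 (q2 - p0) - ?half) + norm (?J (- 1) (p0 - q1) - ?half)"
      by (rule norm_triangle_ineq)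
    also have "\<dots> \<le> L_const \<delta> * (?c1 * (l / 2 * ?e 1 (q2 - p0) + ?B / 2 / (2 * l)) + ?c2 * K * (?D / 2))
        + L_const \<delta> * (?c1 * (l / 2 * ?e (- 1) (p0 - q1) + ?B / 2 / (2 * l)) + ?c2 * K * (?D / 2))"
      by (intro add_mono side l) (use p0 Uq in auto)
    also have "\<dots> = L_const \<delta> * (?c1 * (l / 2 * ?E + ?B / (2 * l)) + ?c2 * K * ?D)"
    proof -
      have alg: "L * (c * (l * e + B / 2 / k) + d * K * (D / 2)) + L * (c * (l * e' + B / 2 / k) + d * K * (D / 2))
        = L * (c * (l * (e + e') + B / k) + d * K * D)" for L c e e' B k d D l :: real
        by (simp add: algebra_simps add_divide_distrib)
      show ?thesis unfolding E by (rule alg)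
    qed
    finally show ?thesis .
  qed
  have "(norm (?I - ?main) / L_const \<delta> - ?c2 * K * ?D) / ?c1 \<le> sqrt (?E * ?B)"
  proof (rule le_sqrt_mult_if_le_weighted_mean)
    fix l :: real assume "0 < l"
    then have "norm (?I - ?main) / L_const \<delta> \<le> ?c1 * (l / 2 * ?E + ?B / (2 * l)) + ?c2 * K * ?D"
      using N[of l] L by (simp add: pos_divide_le_eq mult.commute)
    then show "(norm (?I - ?main) / L_const \<delta> - ?c2 * K * ?D) / ?c1 \<le> l / 2 * ?E + ?B / (2 * l)"
      using c(1) by (subst pos_divide_le_eq) (auto simp: mult.commute)
  qed (use \<delta> in \<open>auto intro!: integral_nonneg integrable_continuous_interval continuous_on_power continuous_on_norm U'\<close>)
  then have "norm (?I - ?main) / L_const \<delta> - ?c2 * K * ?D \<le> sqrt (?E * ?B) * ?c1"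
    using c(1) by (simp only: pos_divide_le_eq)
  then have "norm (?I - ?main) / L_const \<delta> \<le> ?c1 * sqrt (?E * ?B) + ?c2 * K * ?D"
    by (simp add: mult.commute)
  then show ?thesis
    using L by (simp only: pos_divide_le_eq mult.commute)
qed

end

context convex_phase
begin

text \<open>
  Multiplying the phase by a positive parameter multiplies \<open>m\<close>, \<open>M\<close> and \<open>T\<close> by it, and both
  remainder constants are homogeneous of degree \<open>- \<delta>\<close>. A negative parameter is reduced to a positive
  one by complex conjugation.
\<close>

lemma stationary_phase_bound:
  fixes U U' :: "real \<Rightarrow> complex"
  assumes t: "t \<noteq> 0" and p0: "p0 \<in> {q1..q2}"
    and U: "\<And>p. p \<in> {q1..q2} \<Longrightarrow> (U has_vector_derivative U' p) (at p)"
    and U': "continuous_on {q1..q2} U'"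
    and Uq: "U q1 = 0" "U q2 = 0" and K: "\<And>p. p \<in> {q1..q2} \<Longrightarrow> norm (U p) \<le> K"
    and \<delta>: "1 / 2 < \<delta>" "\<delta> < 3 / 4"
  shows "norm (integral {q1..q2} (\<lambda>p. U p * cis (- (t * (f p - f p0 - f1 p0 * (p - p0)))))
           - U p0 * of_real (sqrt (2 * pi / f2 p0) * \<bar>t\<bar> powr (- 1 / 2)) * cis (- (sgn t * (pi / 4))))
    \<le> L_const \<delta> * (2 powr \<delta> * M powr (1 - \<delta>) / m *
          sqrt (integral {q1..q2} (\<lambda>p. (norm (U' p))\<^sup>2) * (2 * (q2 - q1) powr (3 - 4 * \<delta>) / (3 - 4 * \<delta>)))
        + 2 powr \<delta> * T * M * m powr (- 2 - \<delta>) / 3 * K * ((q2 - q1) powr (2 - 2 * \<delta>) / (1 - \<delta>)))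
      * \<bar>t\<bar> powr (- \<delta>)"
    (is "_ \<le> L_const \<delta> * (?c1 * ?S + ?c2 * K * ?D) * _")
proof -
  have M0: "0 < M" using f2_bounds[OF p0] m by linarith
  have T0: "0 \<le> T" using f3_bound[OF p0] by linarith
  have f20: "0 < f2 p0" using f2_bounds[OF p0] m by linarith
  have pos: "norm (integral {q1..q2} (\<lambda>p. V p * cis (- (s * (f p - f p0 - f1 p0 * (p - p0)))))
           - V p0 * of_real (sqrt (2 * pi / f2 p0) * s powr (- 1 / 2)) * cis (- (pi / 4)))
      \<le> L_const \<delta> * (?c1 * sqrt (integral {q1..q2} (\<lambda>p. (norm (V' p))\<^sup>2) * (2 * (q2 - q1) powr (3 - 4 * \<delta>) / (3 - 4 * \<delta>))) + ?c2 * K * ?D) * s powr (- \<delta>)"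
    if s: "0 < s" and V: "\<And>p. p \<in> {q1..q2} \<Longrightarrow> (V has_vector_derivative V' p) (at p)"
      "continuous_on {q1..q2} V'" "V q1 = 0" "V q2 = 0" "\<And>p. p \<in> {q1..q2} \<Longrightarrow> norm (V p) \<le> K"
    for s and V V' :: "real \<Rightarrow> complex"
  proof -
    interpret S: convex_phase "\<lambda>p. s * f p" "\<lambda>p. s * f1 p" "\<lambda>p. s * f2 p" "\<lambda>p. s * f3 p" q1 q2 "s * m" "s * M" "s * T"
      using s by (rule scaled_convex_phase)
    have phase: "s * f p - s * f p0 - s * f1 p0 * (p - p0) = s * (f p - f p0 - f1 p0 * (p - p0))" for p
      by (simp add: algebra_simps)
    have main: "sqrt (2 * pi / (s * f2 p0)) = sqrt (2 * pi / f2 p0) * s powr (- 1 / 2)"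
    proof -
      have "s powr (- 1 / 2) = 1 / sqrt s"
        using s powr_minus_divide[of s "1 / 2"] by (simp add: powr_half_sqrt)
      then show ?thesis by (simp add: real_sqrt_mult real_sqrt_divide)
    qed
    have e1: "s powr (1 - \<delta>) / s = s powr (- \<delta>)"
      using s powr_diff[of s "1 - \<delta>" 1] by simp
    have e2: "s * s * s powr (- 2 - \<delta>) = s powr (- \<delta>)"
    proof -
      have "s * s = s powr 2" using s by (simp add: power2_eq_square)
      then show ?thesis by (simp flip: powr_add)
    qed
    have c1: "2 powr \<delta> * (s * M) powr (1 - \<delta>) / (s * m) = ?c1 * s powr (- \<delta>)"
    proof -
      have "2 powr \<delta> * (s * M) powr (1 - \<delta>) / (s * m) = ?c1 * (s powr (1 - \<delta>) / s)"
        using s M0 by (simp add: powr_mult mult_ac)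
      then show ?thesis unfolding e1 .
    qed
    have c2: "2 powr \<delta> * (s * T) * (s * M) * (s * m) powr (- 2 - \<delta>) / 3 = ?c2 * s powr (- \<delta>)"
    proof -
      have "2 powr \<delta> * (s * T) * (s * M) * (s * m) powr (- 2 - \<delta>) / 3 = ?c2 * (s * s * s powr (- 2 - \<delta>))"
        using s m by (simp add: powr_mult)
      then show ?thesis unfolding e2 .
    qed
    have alg: "L * (c * e * S + d * e * K * D) = L * (c * S + d * K * D) * e" for L c e S d D :: real
      by (simp add: algebra_simps)
    show ?thesis
      using S.stationary_phase_expansion[where U = V and U' = V', OF p0 V \<delta>]
      unfolding phase main c1 c2 alg .
  qed
  show ?thesis
  proof (cases "0 < t")
    case True
    then show ?thesis using pos[where V = U and V' = U', OF _ U U' Uq K] by simp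
  next
    case False
    with t have t': "0 < - t" by simp
    have V: "((\<lambda>p. cnj (U p)) has_vector_derivative cnj (U' p)) (at p)" if "p \<in> {q1..q2}" for p
      using U[OF that] by (rule has_vector_derivative_cnj)
    have V': "continuous_on {q1..q2} (\<lambda>p. cnj (U' p))"
      using U' by (intro continuous_on_cnj)
    let ?X = "integral {q1..q2} (\<lambda>p. U p * cis (- (t * (f p - f p0 - f1 p0 * (p - p0)))))
           - U p0 * of_real (sqrt (2 * pi / f2 p0) * \<bar>t\<bar> powr (- 1 / 2)) * cis (- (sgn t * (pi / 4)))"
    have cX: "cnj ?X = integral {q1..q2} (\<lambda>p. cnj (U p) * cis (- (- t * (f p - f p0 - f1 p0 * (p - p0)))))
           - cnj (U p0) * of_real (sqrt (2 * pi / f2 p0) * (- t) powr (- 1 / 2)) * cis (- (pi / 4))"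
      using t' by (simp add: Henstock_Kurzweil_Integration.integral_cnj cis_cnj)
    have "norm ?X = norm (cnj ?X)" by (rule complex_mod_cnj[symmetric])
    then show ?thesis
      using pos[where V = "\<lambda>p. cnj (U p)" and V' = "\<lambda>p. cnj (U' p)", OF t' V V'] t' Uq K
      unfolding cX by simp
  qed
qed

end

section \<open>Phases without stationary point\<close>

text \<open>
  One integration by parts. The term containing \<open>U'\<close> is estimated by the weighted means as above; the
  term containing \<open>g2\<close> is \<open>K\<close> times the integral of the derivative of \<open>- 1 / g1\<close>, and because \<open>g1\<close>
  keeps its sign, this increment is at most \<open>1 / \<mu>\<close> rather than \<open>2 / \<mu>\<close>.
\<close>

lemma nonstationary_phase_bound:
  fixes U U' :: "real \<Rightarrow> complex" and g g1 g2 :: "real \<Rightarrow> real"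
  assumes ab: "a \<le> b" and t: "t \<noteq> 0" and \<mu>: "0 < \<mu>"
    and g: "\<And>p. p \<in> {a..b} \<Longrightarrow> (g has_real_derivative g1 p) (at p)"
    and g1: "\<And>p. p \<in> {a..b} \<Longrightarrow> (g1 has_real_derivative g2 p) (at p)"
    and g2: "continuous_on {a..b} g2" "\<And>p. p \<in> {a..b} \<Longrightarrow> 0 \<le> g2 p"
    and away: "(\<forall>p\<in>{a..b}. \<mu> \<le> g1 p) \<or> (\<forall>p\<in>{a..b}. g1 p \<le> - \<mu>)"
    and U: "\<And>p. p \<in> {a..b} \<Longrightarrow> (U has_vector_derivative U' p) (at p)"
    and U': "continuous_on {a..b} U'"
    and Uab: "U a = 0" "U b = 0" and K: "\<And>p. p \<in> {a..b} \<Longrightarrow> norm (U p) \<le> K"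
  shows "norm (integral {a..b} (\<lambda>p. U p * cis (- (t * g p))))
    \<le> (sqrt (integral {a..b} (\<lambda>p. (norm (U' p))\<^sup>2) * (b - a)) + K) / \<mu> * inverse \<bar>t\<bar>"
    (is "norm ?I \<le> (sqrt (?E * _) + K) / \<mu> * _")
proof -
  have g1_nz: "g1 p \<noteq> 0" and g1_abs: "\<mu> \<le> \<bar>g1 p\<bar>" if "p \<in> {a..b}" for p
    using away that \<mu> by fastforce+
  have K0: "0 \<le> K" using order_trans[OF norm_ge_zero K[of a]] ab by simp
  have contU: "continuous_on {a..b} U"
    using U by (meson continuous_at_imp_continuous_on has_vector_derivative_continuous)
  have contg: "continuous_on {a..b} g" "continuous_on {a..b} g1"
    using g g1 by (meson continuous_at_imp_continuous_on DERIV_isCont)+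
  let ?r = "\<lambda>p. (U' p / of_real (g1 p) - U p * of_real (g2 p / (g1 p)\<^sup>2)) * cis (- (t * g p))"
  have deriv: "((\<lambda>p. U p * of_real (1 / g1 p) * cis (- (t * g p))) has_vector_derivative
      ?r p - \<i> * of_real t * (U p * cis (- (t * g p)))) (at p)" if p: "p \<in> {a..b}" for p
  proof -
    have "((\<lambda>p. 1 / g1 p) has_real_derivative - (g2 p / (g1 p)\<^sup>2)) (at p)"
      using DERIV_inverse_fun[OF g1[OF p] g1_nz[OF p]] g1_nz[OF p]
      by (simp add: inverse_eq_divide power2_eq_square)
    note inv = has_vector_derivative_of_real[OF this]
    have "((\<lambda>p. - (t * g p)) has_real_derivative - (t * g1 p)) (at p)"
      by (intro DERIV_minus DERIV_cmult g p)
    then have "((\<lambda>p. - (t * g p)) has_vector_derivative - (t * g1 p)) (at p)"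
      by (simp only: has_real_derivative_iff_has_vector_derivative)
    then have "((\<lambda>p. cis (- (t * g p))) has_vector_derivative
        of_real (- (t * g1 p)) * (\<i> * cis (- (t * g p)))) (at p)"
      using vector_diff_chain_at[OF _ has_vector_derivative_cis] unfolding o_def scaleR_conv_of_real by blast
    note mult = has_vector_derivative_mult[OF has_vector_derivative_mult[OF U[OF p] inv] this]
    show ?thesis
      by (rule has_vector_derivative_eq_rhs[OF mult])
         (use g1_nz[OF p] in \<open>simp add: field_simps\<close>)
  qed
  have FTC: "((\<lambda>p. ?r p - \<i> * of_real t * (U p * cis (- (t * g p)))) has_integral
      (U b * of_real (1 / g1 b) * cis (- (t * g b)) - U a * of_real (1 / g1 a) * cis (- (t * g a)))) {a..b}"
    using ab deriv by (intro fundamental_theorem_of_calculus) (auto intro: has_vector_derivative_at_within)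
  have "continuous_on {a..b} (\<lambda>p. U p * cis (- (t * g p)))"
    by (intro continuous_on_mult continuous_on_cis continuous_on_minus continuous_on_const contU contg)
  then have "((\<lambda>p. U p * cis (- (t * g p))) has_integral ?I) {a..b}"
    by (intro integrable_integral integrable_continuous_interval)
  from has_integral_add[OF FTC has_integral_mult_right[OF this, of "\<i> * of_real t"]]
  have r: "(?r has_integral (\<i> * of_real t * ?I)) {a..b}"
    using Uab by simp
  have G: "((\<lambda>p. g2 p / (g1 p)\<^sup>2) has_integral (- (1 / g1 b) - - (1 / g1 a))) {a..b}"
  proof (rule fundamental_theorem_of_calculus[OF ab])
    fix p assume p: "p \<in> {a..b}"
    have "((\<lambda>p. - (1 / g1 p)) has_real_derivative g2 p / (g1 p)\<^sup>2) (at p)"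
      using DERIV_minus[OF DERIV_inverse_fun[OF g1[OF p] g1_nz[OF p]]] g1_nz[OF p]
      by (simp add: inverse_eq_divide power2_eq_square)
    then show "((\<lambda>p. - (1 / g1 p)) has_vector_derivative g2 p / (g1 p)\<^sup>2) (at p within {a..b})"
      by (simp add: has_real_derivative_iff_has_vector_derivative has_vector_derivative_at_within)
  qed
  have G_le: "1 / g1 a - 1 / g1 b \<le> 1 / \<mu>"
  proof (cases "\<forall>p\<in>{a..b}. \<mu> \<le> g1 p")
    case True
    then have "\<mu> \<le> g1 a" "\<mu> \<le> g1 b" using ab by auto
    then have "1 / g1 a \<le> 1 / \<mu>" "0 \<le> 1 / g1 b" using \<mu> by (auto simp: frac_le)
    then show ?thesis by linarith
  next
    case False
    then have "g1 a \<le> - \<mu>" "g1 b \<le> - \<mu>" using away ab by auto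
    then have "- (1 / g1 b) \<le> 1 / \<mu>" "1 / g1 a \<le> 0"
      using frac_le[of 1 1 \<mu> "- g1 b"] \<mu> by (auto simp: divide_nonneg_nonpos)
    then show ?thesis by linarith
  qed
  have E: "((\<lambda>p. (norm (U' p))\<^sup>2) has_integral ?E) {a..b}"
    by (intro integrable_integral integrable_continuous_interval continuous_on_power continuous_on_norm U')
  have "norm ?I * \<bar>t\<bar> * \<mu> - K \<le> sqrt (?E * (b - a))"
  proof (rule le_sqrt_mult_if_le_weighted_mean)
    fix l :: real assume l: "0 < l"
    have dom: "((\<lambda>p. (l / 2 * (norm (U' p))\<^sup>2 + 1 / (2 * l)) / \<mu> + K * (g2 p / (g1 p)\<^sup>2)) has_integral
        (l / 2 * ?E + (b - a) / (2 * l)) / \<mu> + K * (1 / g1 a - 1 / g1 b)) {a..b}"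
    proof -
      have "((\<lambda>p. 1 / (2 * l)) has_integral (b - a) / (2 * l)) {a..b}"
        using has_integral_const_real[of "1 / (2 * l)" a b] ab by simp
      note first = has_integral_divide[OF has_integral_add[OF has_integral_mult_right[OF E] this]]
      have "((\<lambda>p. g2 p / (g1 p)\<^sup>2) has_integral (1 / g1 a - 1 / g1 b)) {a..b}"
        using G by simp
      from has_integral_add[OF first has_integral_mult_right[OF this]] show ?thesis .
    qed
    have "norm (integral {a..b} ?r) \<le> integral {a..b}
        (\<lambda>p. (l / 2 * (norm (U' p))\<^sup>2 + 1 / (2 * l)) / \<mu> + K * (g2 p / (g1 p)\<^sup>2))"
    proof (rule Henstock_Kurzweil_Integration.integral_norm_bound_integral)
      show "?r integrable_on {a..b}" using r by blast
      show "(\<lambda>p. (l / 2 * (norm (U' p))\<^sup>2 + 1 / (2 * l)) / \<mu> + K * (g2 p / (g1 p)\<^sup>2)) integrable_on {a..b}"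
        using dom by blast
      fix p assume p: "p \<in> {a..b}"
      have "0 \<le> (l * norm (U' p) - 1)\<^sup>2 / (2 * l)" using l by simp
      also have "\<dots> = l / 2 * (norm (U' p))\<^sup>2 + 1 / (2 * l) - norm (U' p)"
        using l by (simp add: field_simps power2_eq_square)
      finally have amgm: "norm (U' p) \<le> l / 2 * (norm (U' p))\<^sup>2 + 1 / (2 * l)" by simp
      have "norm (?r p) \<le> norm (U' p) / \<bar>g1 p\<bar> + norm (U p) * (g2 p / (g1 p)\<^sup>2)"
        using norm_triangle_ineq4[of "U' p / of_real (g1 p)" "U p * of_real (g2 p / (g1 p)\<^sup>2)"] g2(2)[OF p]
        by (simp add: norm_mult norm_divide norm_power)
      also have "\<dots> \<le> (l / 2 * (norm (U' p))\<^sup>2 + 1 / (2 * l)) / \<mu> + K * (g2 p / (g1 p)\<^sup>2)"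
        using \<mu> l g1_abs[OF p] K[OF p] g2(2)[OF p] amgm by (intro add_mono mult_right_mono frac_le) auto
      finally show "norm (?r p) \<le> (l / 2 * (norm (U' p))\<^sup>2 + 1 / (2 * l)) / \<mu> + K * (g2 p / (g1 p)\<^sup>2)" .
    qed
    also have "\<dots> = (l / 2 * ?E + (b - a) / (2 * l)) / \<mu> + K * (1 / g1 a - 1 / g1 b)"
      by (rule integral_unique[OF dom])
    also have "\<dots> \<le> (l / 2 * ?E + (b - a) / (2 * l)) / \<mu> + K * (1 / \<mu>)"
      using G_le K0 by (intro add_left_mono mult_left_mono)
    finally have "\<bar>t\<bar> * norm ?I \<le> (l / 2 * ?E + (b - a) / (2 * l) + K) / \<mu>"
      using r by (simp add: has_integral_iff norm_mult add_divide_distrib)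
    then show "norm ?I * \<bar>t\<bar> * \<mu> - K \<le> l / 2 * ?E + (b - a) / (2 * l)"
      using \<mu> by (simp add: pos_le_divide_eq mult_ac)
  qed (use ab E in \<open>auto intro!: integral_nonneg simp: has_integral_iff\<close>)
  then have "norm ?I * (\<bar>t\<bar> * \<mu>) \<le> sqrt (?E * (b - a)) + K" by (simp add: mult.assoc)
  then show ?thesis
    using \<mu> t by (simp add: field_simps)
qed

section \<open>Plancherel's identity for continuous functions of compact support\<close>

lemma continuous_compact_support:
  fixes g :: "real \<Rightarrow> 'b::euclidean_space"
  assumes "continuous_on UNIV g" and "\<And>x. x \<notin> {a..b} \<Longrightarrow> g x = 0"
  shows integrable_continuous_compact_support: "integrable lborel g"
    and LINT_continuous_compact_support: "(LINT x|lborel. g x) = integral {a..b} g"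
    and bounded_continuous_compact_support: "\<exists>B. \<forall>x. norm (g x) \<le> B"
proof -
  have cont: "continuous_on {a..b} g"
    using assms(1) by (rule continuous_on_subset) simp
  have ind: "(\<lambda>x. indicator {a..b} x *\<^sub>R g x) = g"
    using assms(2) by (auto simp: indicator_def)
  have int: "set_integrable lborel {a..b} g"
    using borel_integrable_atLeastAtMost'[OF cont] .
  then show "integrable lborel g"
    by (simp add: set_integrable_def ind)
  show "(LINT x|lborel. g x) = integral {a..b} g"
    using set_borel_integral_eq_integral(2)[OF int] by (simp add: set_lebesgue_integral_def ind)
  have "bounded (g ` {a..b})"
    using cont by (intro compact_imp_bounded compact_continuous_image) auto
  then obtain B where B: "\<And>x. x \<in> {a..b} \<Longrightarrow> norm (g x) \<le> B"
    unfolding bounded_iff by blast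
  have "norm (g x) \<le> max B 0" for x
    using B[of x] assms(2)[of x] by (cases "x \<in> {a..b}") (auto simp: max.coboundedI1)
  then show "\<exists>B. \<forall>x. norm (g x) \<le> B" by blast
qed

lemma LINT_swap_bounded_kernel:
  fixes u v :: "real \<Rightarrow> complex"
  assumes u: "integrable lborel u" and v: "integrable lborel v"
    and k: "(\<lambda>(x, y). k x y) \<in> borel_measurable (lborel \<Otimes>\<^sub>M lborel)"
    and k1: "\<And>x y. norm (k x y) \<le> 1"
  shows "(LINT x|lborel. u x * (LINT y|lborel. v y * k x y)) =
         (LINT y|lborel. v y * (LINT x|lborel. u x * k x y))"
proof -
  note [measurable] = u[THEN borel_measurable_integrable] v[THEN borel_measurable_integrable] k
  have meas: "(\<lambda>(x, y). u x * (v y * k x y)) \<in> borel_measurable (lborel \<Otimes>\<^sub>M lborel)"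
    by measurable
  have "integrable (lborel \<Otimes>\<^sub>M lborel) (\<lambda>(x, y). u x * (v y * k x y))"
  proof (rule Bochner_Integration.integrable_bound)
    show "integrable (lborel \<Otimes>\<^sub>M lborel) (\<lambda>(x, y). u x * v y)"
    proof (rule lborel_pair.Fubini_integrable)
      show "integrable lborel (\<lambda>x. LINT y|lborel. norm (case (x, y) of (x, y) \<Rightarrow> u x * v y))"
        using u by (simp add: norm_mult)
    qed (use v in auto)
    show "AE z in lborel \<Otimes>\<^sub>M lborel. norm (case z of (x, y) \<Rightarrow> u x * (v y * k x y))
        \<le> norm (case z of (x, y) \<Rightarrow> u x * v y)"
      using k1 by (auto simp: norm_mult mult_le_cancel_left1 intro!: AE_I2 mult_left_mono mult_left_le)
  qed (use meas in simp)
  from lborel_pair.Fubini_integral[OF this]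
  have "(LINT x|lborel. LINT y|lborel. u x * (v y * k x y)) =
      (LINT y|lborel. LINT x|lborel. v y * (u x * k x y))" by (simp only: mult.left_commute)
  then show ?thesis by simp
qed

lemma LINT_gaussian_cis:
  fixes s :: real
  assumes e: "0 < e"
  shows "(LINT y|lborel. of_real (std_normal_density (e * y)) * cis (s * y)) =
         of_real (std_normal_density (s / e) * sqrt (2 * pi) / e)"
proof -
  have char: "(LINT y|lborel. of_real (std_normal_density y) * cis (s * y)) =
      of_real (std_normal_density s * sqrt (2 * pi))" for s
  proof -
    have "char std_normal_distribution s = (LINT y|lborel. of_real (std_normal_density y) * cis (s * y))"
      unfolding char_def
      by (subst integral_density)
         (auto simp: normal_density_nonneg cis_conv_exp scaleR_conv_of_real intro!: borel_measurable_continuous_onI continuous_intros)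
    then have "(LINT y|lborel. of_real (std_normal_density y) * cis (s * y)) = of_real (exp (- s\<^sup>2 / 2))"
      by (simp only: char_std_normal_distribution)
    also have "exp (- s\<^sup>2 / 2) = std_normal_density s * sqrt (2 * pi)"
      by (simp add: std_normal_density_def)
    finally show ?thesis .
  qed
  have "(LINT y|lborel. of_real (std_normal_density (e * y)) * cis (s * y)) =
      (1 / e) *\<^sub>R (LINT y|lborel. of_real (std_normal_density y) * cis (s / e * y))"
    using e by (subst lborel_integral_real_affine[of "1 / e" _ 0]) auto
  also have "\<dots> = of_real (std_normal_density (s / e) * sqrt (2 * pi) / e)"
    using e unfolding char by (simp add: scaleR_conv_of_real)
  finally show ?thesis .
qed

lemma std_normal_density_integral:
  "integrable lborel std_normal_density" "(LINT y|lborel. std_normal_density y) = 1"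
  by (auto intro: integrable_normal_density integral_normal_density)

text \<open>
  Inserting a Gaussian makes all the integrals absolutely convergent, so that the order of integration
  can be exchanged twice. Its transform is again a Gaussian, concentrated at scale \<open>e\<close>.
\<close>

lemma LINT_gaussian_norm_fourier:
  fixes g :: "real \<Rightarrow> complex"
  assumes g: "integrable lborel g" and e: "0 < e"
    and h: "\<And>y. h y = (LINT p|lborel. g p * cis (p * y))"
  shows "(LINT y|lborel. std_normal_density (e * y) * (cmod (h y))\<^sup>2) =
         (LINT p|lborel. g p * (LINT z|lborel. cnj (g (p + e * z)) * of_real (std_normal_density z))) * sqrt (2 * pi)"
    and "integrable lborel (\<lambda>y. std_normal_density (e * y) * (cmod (h y))\<^sup>2)"
    and "h \<in> borel_measurable borel"
proof -
  note [measurable] = g[THEN borel_measurable_integrable]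
  have cg: "integrable lborel (\<lambda>p. cnj (g p))" using g by simp
  have [measurable]: "cis \<in> borel_measurable borel"
    by (intro borel_measurable_continuous_onI continuous_intros)
  have [measurable]: "cnj \<in> borel_measurable borel"
    by (intro borel_measurable_continuous_onI continuous_intros)
  show meas_h [measurable]: "h \<in> borel_measurable borel"
    unfolding h[abs_def] by measurable
  let ?D = "\<lambda>y. complex_of_real (std_normal_density (e * y))"
  have cnj_h: "cnj (h y) = (LINT q|lborel. cnj (g q) * cis (- (q * y)))" for y
    unfolding h Bochner_Integration.integral_cnj[symmetric] by (simp only: complex_cnj_mult cis_cnj)
  have hb: "cmod (h y) \<le> (LINT p|lborel. cmod (g p))" for y
    unfolding h by (rule order_trans[OF integral_norm_bound]) (simp add: norm_mult)
  have D: "integrable lborel (\<lambda>y. std_normal_density (e * y))"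
    using std_normal_density_integral(1) e lborel_integrable_real_affine[of std_normal_density e 0] by simp
  have D': "integrable lborel (\<lambda>y. ?D y * cis (p * y))" for p
    by (rule Bochner_Integration.integrable_bound[OF D]) (auto simp: norm_mult)
  have Dh: "integrable lborel (\<lambda>y. ?D y * cnj (h y))"
    by (rule Bochner_Integration.integrable_bound[OF integrable_mult_right[OF D, of "LINT p|lborel. cmod (g p)"]])
       (auto simp: norm_mult abs_mult mult.commute[of _ "LINT p|lborel. _"] mult.commute[of "std_normal_density _"]
         intro!: mult_right_mono hb AE_I2 order_trans[OF hb abs_ge_self])
  \<comment> \<open>The substitution \<open>q = p + e z\<close> turns the transformed Gaussian into an average of \<open>g\<close> around \<open>p\<close>.\<close>
  have inner: "(LINT y|lborel. ?D y * cnj (h y) * cis (p * y)) =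
      sqrt (2 * pi) * (LINT z|lborel. cnj (g (p + e * z)) * of_real (std_normal_density z))" for p
  proof -
    have "(LINT y|lborel. ?D y * cnj (h y) * cis (p * y)) =
        (LINT y|lborel. (?D y * cis (p * y)) * (LINT q|lborel. cnj (g q) * cis (- (q * y))))"
      by (simp add: cnj_h mult_ac)
    also have "\<dots> = (LINT q|lborel. cnj (g q) * (LINT y|lborel. (?D y * cis (p * y)) * cis (- (q * y))))"
      by (rule LINT_swap_bounded_kernel[OF D' cg]) auto
    also have "\<dots> = (LINT q|lborel. cnj (g q) * of_real (std_normal_density ((p - q) / e) * sqrt (2 * pi) / e))"
      by (intro Bochner_Integration.integral_cong refl, subst LINT_gaussian_cis[OF e, symmetric])
         (simp add: mult.assoc cis_mult left_diff_distrib)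
    also have "\<dots> = e *\<^sub>R (LINT z|lborel. cnj (g (p + e * z)) * of_real (std_normal_density (- z) * sqrt (2 * pi) / e))"
      using e by (subst lborel_integral_real_affine[of e _ p]) auto
    also have "\<dots> = (LINT z|lborel. sqrt (2 * pi) * (cnj (g (p + e * z)) * of_real (std_normal_density z)))"
      using e by (subst integral_scaleR_right[symmetric]) (auto intro!: Bochner_Integration.integral_cong simp: std_normal_density_def scaleR_conv_of_real)
    finally show ?thesis by simp
  qed
  have "complex_of_real (LINT y|lborel. std_normal_density (e * y) * (cmod (h y))\<^sup>2) =
      (LINT y|lborel. (?D y * cnj (h y)) * h y)"
    by (subst integral_complex_of_real[symmetric], rule Bochner_Integration.integral_cong)
       (simp_all add: mult_ac flip: complex_norm_square)
  also have "\<dots> = (LINT y|lborel. (?D y * cnj (h y)) * (LINT p|lborel. g p * cis (p * y)))"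
    by (simp only: h)
  also have "\<dots> = (LINT p|lborel. g p * (LINT y|lborel. (?D y * cnj (h y)) * cis (p * y)))"
    by (rule LINT_swap_bounded_kernel[OF Dh g]) auto
  also have "\<dots> = (LINT p|lborel. sqrt (2 * pi) * (g p * (LINT z|lborel. cnj (g (p + e * z)) * of_real (std_normal_density z))))"
    unfolding inner by (simp add: mult_ac)
  finally show "(LINT y|lborel. std_normal_density (e * y) * (cmod (h y))\<^sup>2) =
         (LINT p|lborel. g p * (LINT z|lborel. cnj (g (p + e * z)) * of_real (std_normal_density z))) * sqrt (2 * pi)"
    by (simp add: mult.commute)
  show "integrable lborel (\<lambda>y. std_normal_density (e * y) * (cmod (h y))\<^sup>2)"
    by (rule Bochner_Integration.integrable_bound[OF integrable_mult_right[OF D, of "(LINT p|lborel. cmod (g p))\<^sup>2"]])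
       (auto simp: abs_mult mult.commute intro!: mult_mono power_mono hb)
qed

lemma LINT_approximate_identity:
  fixes g :: "real \<Rightarrow> complex"
  assumes cont: "continuous_on UNIV g" and B: "\<And>p. cmod (g p) \<le> B" and e: "e \<longlonglongrightarrow> 0"
  shows "(\<lambda>n. LINT z|lborel. cnj (g (p + e n * z)) * of_real (std_normal_density z)) \<longlonglongrightarrow> cnj (g p)"
proof -
  have [measurable]: "g \<in> borel_measurable borel"
    using cont by (rule borel_measurable_continuous_onI)
  have [measurable]: "cnj \<in> borel_measurable borel"
    by (intro borel_measurable_continuous_onI continuous_intros)
  have "(\<lambda>n. LINT z|lborel. cnj (g (p + e n * z)) * of_real (std_normal_density z))
      \<longlonglongrightarrow> (LINT z|lborel. cnj (g p) * of_real (std_normal_density z))"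
  proof (rule integral_dominated_convergence[where w = "\<lambda>z. B * std_normal_density z"])
    show "AE z in lborel. (\<lambda>n. cnj (g (p + e n * z)) * of_real (std_normal_density z))
        \<longlonglongrightarrow> cnj (g p) * of_real (std_normal_density z)"
    proof (intro AE_I2 tendsto_intros)
      fix z
      have "(\<lambda>n. p + e n * z) \<longlonglongrightarrow> p + 0 * z" by (intro tendsto_intros e)
      then show "(\<lambda>n. g (p + e n * z)) \<longlonglongrightarrow> g p"
        using continuous_on_tendsto_compose[OF cont, of "\<lambda>n. p + e n * z" p] by simp
    qed
    show "AE z in lborel. cmod (cnj (g (p + e n * z)) * of_real (std_normal_density z)) \<le> B * std_normal_density z" for n
      using B by (auto simp: norm_mult intro!: mult_right_mono)
  qed (auto intro: std_normal_density_integral)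
  also have "(LINT z|lborel. cnj (g p) * of_real (std_normal_density z)) = cnj (g p)"
    by (simp only: integral_mult_right_zero integral_complex_of_real std_normal_density_integral of_real_1 mult_1_right)
  finally show ?thesis .
qed

text \<open>
  Let the width of the Gaussian weight tend to infinity. On the Fourier side the weights increase to a
  constant, so monotone convergence yields integrability along with the value; on the other side the
  weight is an approximate identity.
\<close>

lemma plancherel_compact_support:
  fixes g :: "real \<Rightarrow> complex"
  assumes cont: "continuous_on UNIV g" and supp: "\<And>p. p \<notin> {a..b} \<Longrightarrow> g p = 0"
    and h: "\<And>y. h y = (LINT p|lborel. g p * cis (p * y))"
  shows "integrable lborel (\<lambda>y. (cmod (h y))\<^sup>2)"
    and "(LINT y|lborel. (cmod (h y))\<^sup>2) = 2 * pi * integral {a..b} (\<lambda>p. (cmod (g p))\<^sup>2)"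
proof -
  have g: "integrable lborel g" by (rule integrable_continuous_compact_support[OF cont supp])
  obtain B where B: "\<And>p. cmod (g p) \<le> B"
    using bounded_continuous_compact_support[OF cont supp] by blast
  define e where "e n = 1 / real (Suc n)" for n
  have e: "e n > 0" for n by (simp add: e_def)
  have e0: "e \<longlonglongrightarrow> 0" unfolding e_def by (rule LIMSEQ_Suc[OF lim_1_over_n])
  have dec: "e m \<le> e n" if "n \<le> m" for m n using that by (simp add: e_def field_simps)
  note [measurable] = g[THEN borel_measurable_integrable]
  have [measurable]: "cnj \<in> borel_measurable borel"
    by (intro borel_measurable_continuous_onI continuous_intros)
  note G = LINT_gaussian_norm_fourier[OF g e h]
  have [measurable]: "h \<in> borel_measurable borel" using G(3) .
  let ?N = "integral {a..b} (\<lambda>p. (cmod (g p))\<^sup>2)"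
  have N: "(LINT p|lborel. g p * cnj (g p)) = of_real ?N"
  proof -
    have "(LINT p|lborel. g p * cnj (g p)) = of_real (LINT p|lborel. (cmod (g p))\<^sup>2)"
      unfolding complex_norm_square[symmetric] of_real_power[symmetric] integral_complex_of_real ..
    also have "(LINT p|lborel. (cmod (g p))\<^sup>2) = ?N"
      by (rule LINT_continuous_compact_support) (auto simp: supp intro!: continuous_intros cont)
    finally show ?thesis .
  qed
  have "(\<lambda>n. LINT p|lborel. g p * (LINT z|lborel. cnj (g (p + e n * z)) * of_real (std_normal_density z)))
      \<longlonglongrightarrow> (LINT p|lborel. g p * cnj (g p))"
  proof (rule integral_dominated_convergence[where w = "\<lambda>p. cmod (g p) * B"])
    show "AE p in lborel. (\<lambda>n. g p * (LINT z|lborel. cnj (g (p + e n * z)) * of_real (std_normal_density z)))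
        \<longlonglongrightarrow> g p * cnj (g p)"
      by (intro AE_I2 tendsto_intros LINT_approximate_identity[OF cont B e0])
    show "AE p in lborel. cmod (g p * (LINT z|lborel. cnj (g (p + e n * z)) * of_real (std_normal_density z)))
        \<le> cmod (g p) * B" for n
    proof (rule AE_I2)
      fix p
      have "cmod (LINT z|lborel. cnj (g (p + e n * z)) * of_real (std_normal_density z))
          \<le> (LINT z|lborel. B * std_normal_density z)"
      proof (rule Bochner_Integration.integral_norm_bound_integral)
        show I: "integrable lborel (\<lambda>z. B * std_normal_density z)"
          by (intro integrable_mult_right std_normal_density_integral)
        show "integrable lborel (\<lambda>z. cnj (g (p + e n * z)) * of_real (std_normal_density z))"
          by (rule Bochner_Integration.integrable_bound[OF I])
             (auto simp: norm_mult abs_mult intro!: mult_right_mono order_trans[OF B abs_ge_self])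
      qed (auto simp: norm_mult intro!: mult_right_mono B)
      then show "cmod (g p * (LINT z|lborel. cnj (g (p + e n * z)) * of_real (std_normal_density z)))
          \<le> cmod (g p) * B"
        by (auto simp: norm_mult std_normal_density_integral intro!: mult_left_mono)
    qed
  qed (use g in auto)
  then have "(\<lambda>n. complex_of_real (LINT y|lborel. std_normal_density (e n * y) * (cmod (h y))\<^sup>2))
      \<longlonglongrightarrow> complex_of_real (?N * sqrt (2 * pi))"
    unfolding G(1) N of_real_mult by (intro tendsto_intros)
  then have lim: "(\<lambda>n. LINT y|lborel. std_normal_density (e n * y) * (cmod (h y))\<^sup>2)
      \<longlonglongrightarrow> ?N * sqrt (2 * pi)"
    by (simp only: tendsto_of_real_iff)
  let ?f = "\<lambda>n y. sqrt (2 * pi) * (std_normal_density (e n * y) * (cmod (h y))\<^sup>2)"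
  have f: "?f n y = exp (- (e n * y)\<^sup>2 / 2) * (cmod (h y))\<^sup>2" for n y
    by (simp add: std_normal_density_def)
  have 1: "integrable lborel (?f n)" for n by (intro integrable_mult_right G(2))
  have 2: "AE y in lborel. mono (\<lambda>n. ?f n y)"
    unfolding f
    by (intro AE_I2)
       (auto simp: mono_def power_mult_distrib intro!: mult_right_mono power_mono dec less_imp_le[OF e])
  have 3: "AE y in lborel. 0 \<le> ?f n y" for n unfolding f by simp
  have 4: "AE y in lborel. (\<lambda>n. ?f n y) \<longlonglongrightarrow> (cmod (h y))\<^sup>2"
  proof (rule AE_I2)
    fix y
    have "(\<lambda>n. exp (- (e n * y)\<^sup>2 / 2) * (cmod (h y))\<^sup>2) \<longlonglongrightarrow> exp (- (0 * y)\<^sup>2 / 2) * (cmod (h y))\<^sup>2"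
      by (intro tendsto_intros e0) simp
    then show "(\<lambda>n. ?f n y) \<longlonglongrightarrow> (cmod (h y))\<^sup>2" unfolding f by simp
  qed
  have 5: "(\<lambda>n. integral\<^sup>L lborel (?f n)) \<longlonglongrightarrow> sqrt (2 * pi) * (?N * sqrt (2 * pi))"
    unfolding integral_mult_right_zero by (intro tendsto_intros lim)
  have 6: "(\<lambda>y. (cmod (h y))\<^sup>2) \<in> borel_measurable lborel" by measurable
  note M = integral_monotone_convergence_nonneg[OF 1 2 3 4 5 6]
  show "integrable lborel (\<lambda>y. (cmod (h y))\<^sup>2)" by (rule M(1))
  show "(LINT y|lborel. (cmod (h y))\<^sup>2) = 2 * pi * ?N"
    unfolding M(2) using pi_ge_zero by (simp add: mult_ac flip: real_sqrt_mult)
qed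

section \<open>Fourier transforms of Schwartz functions\<close>

text \<open>
  Decay of two more powers of \<open>x\<close> gives the integrable majorant \<open>C / (1 + x\<^sup>2)\<close>.
\<close>

lemma schwartz_weighted_integrable:
  assumes "schwartz u"
  shows "integrable lborel (\<lambda>x. of_real x ^ k * u x)"
proof -
  have diff: "u differentiable (at x)" for x
    using assms unfolding schwartz_def by (metis funpow_0)
  have "continuous_on UNIV u"
    using diff by (auto intro!: continuous_at_imp_continuous_on differentiable_imp_continuous_within)
  then have [measurable]: "u \<in> borel_measurable borel"
    by (rule borel_measurable_continuous_onI)
  have dec: "\<exists>C. \<forall>x. \<bar>x\<bar> ^ j * cmod (u x) \<le> C" for j
    using assms unfolding schwartz_def by (metis funpow_0)
  obtain C1 where C1: "\<And>x. \<bar>x\<bar> ^ k * cmod (u x) \<le> C1" using dec by blast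
  obtain C2 where C2: "\<And>x. \<bar>x\<bar> ^ (k + 2) * cmod (u x) \<le> C2" using dec by blast
  have "einterval (- \<infinity>) \<infinity> = UNIV" by (auto simp: einterval_def)
  then have "integrable lborel (\<lambda>x::real. inverse (1 + x\<^sup>2))"
    using integrable_inverse_1_plus_square by (simp add: set_integrable_def)
  then have "integrable lborel (\<lambda>x::real. (C1 + C2) * inverse (1 + x\<^sup>2))"
    by (rule integrable_mult_right)
  then show ?thesis
  proof (rule Bochner_Integration.integrable_bound)
    show "AE x in lborel. norm (of_real x ^ k * u x) \<le> norm ((C1 + C2) * inverse (1 + x\<^sup>2))"
    proof (rule AE_I2)
      fix x :: real
      have "\<bar>x\<bar> ^ k * cmod (u x) * (1 + x\<^sup>2) = \<bar>x\<bar> ^ k * cmod (u x) + \<bar>x\<bar> ^ (k + 2) * cmod (u x)"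
        by (simp add: algebra_simps power2_eq_square abs_mult_self_eq flip: abs_mult)
      also have "\<dots> \<le> C1 + C2" using C1[of x] C2[of x] by linarith
      finally have "\<bar>x\<bar> ^ k * cmod (u x) \<le> (C1 + C2) * inverse (1 + x\<^sup>2)"
        by (simp add: pos_le_divide_eq add_pos_nonneg flip: divide_inverse)
      then show "norm (of_real x ^ k * u x) \<le> norm ((C1 + C2) * inverse (1 + x\<^sup>2))"
        by (simp add: norm_mult norm_power)
    qed
  qed measurable
qed

lemma norm_fourier_le: "cmod (fourier u p) \<le> L1_norm u"
  unfolding fourier_def L1_norm_def
  by (rule order_trans[OF integral_norm_bound]) (simp add: norm_mult)

lemma fourier_has_vector_derivative:
  assumes "integrable lborel u" and "integrable lborel (\<lambda>x. of_real x * u x)"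
  shows "(fourier u has_vector_derivative fourier (\<lambda>x. - \<i> * (of_real x * u x)) p) (at p)"
proof -
  note [measurable] = assms[THEN borel_measurable_integrable]
  have "((\<lambda>p. LINT x|lborel. u x * exp (- \<i> * of_real x * of_real p)) has_vector_derivative
      (LINT x|lborel. - \<i> * (of_real x * u x) * exp (- \<i> * of_real x * of_real p))) (at p within UNIV)"
  proof (rule has_vector_derivative_LINT)
    show "integrable lborel (\<lambda>x. u x * exp (- \<i> * of_real x * of_real p))" for p
      by (rule Bochner_Integration.integrable_bound[OF assms(1)]) (auto simp: norm_mult)
    show "((\<lambda>p. u x * exp (- \<i> * of_real x * of_real p)) has_vector_derivative
        - \<i> * (of_real x * u x) * exp (- \<i> * of_real x * of_real p)) (at p within UNIV)" for x p
    proof -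
      have "((\<lambda>z. u x * exp (- \<i> * of_real x * z)) has_field_derivative
          - \<i> * (of_real x * u x) * exp (- \<i> * of_real x * of_real p)) (at (of_real p))"
        by (auto intro!: derivative_eq_intros)
      then show ?thesis by (rule has_vector_derivative_real_field)
    qed
    show "norm (- \<i> * (of_real x * u x) * exp (- \<i> * of_real x * of_real p)) \<le> norm (of_real x * u x)" for x p
      by (simp add: norm_mult)
    show "integrable lborel (\<lambda>x. norm (of_real x * u x))"
      using assms(2) by (rule integrable_norm)
    show "(\<lambda>x. - \<i> * (of_real x * u x) * exp (- \<i> * of_real x * of_real p)) \<in> borel_measurable lborel"
      by measurable
  qed auto
  then show ?thesis by (simp add: fourier_def[abs_def])
qed

text \<open>
  The support condition leaves the values at the end points open; continuity settles them.
\<close>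

lemma continuous_zero_boundary:
  fixes g :: "real \<Rightarrow> complex"
  assumes g: "continuous_on UNIV g" and zero: "\<And>p. p \<notin> {a..b} \<Longrightarrow> g p = 0"
  shows "g a = 0" "g b = 0"
proof -
  have "g a = 0 \<and> g b = 0"
  proof
    have "a \<in> closure {..<a}" "b \<in> closure {b<..}" by auto
    moreover have "closed {x. g x = 0}"
      using g by (intro closed_Collect_eq) auto
    moreover have "{..<a} \<subseteq> {x. g x = 0}" "{b<..} \<subseteq> {x. g x = 0}" using zero by auto
    ultimately show "g a = 0" "g b = 0"
      using closure_minimal by blast+
  qed
  then show "g a = 0" "g b = 0" by auto
qed

section \<open>The translated profile of a band-limited packet\<close>

text \<open>
  The packet seen from the space-time point \<open>(t0, x0)\<close>.
\<close>

locale band_limited_packet =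
  fixes f f1 :: "real \<Rightarrow> real" and u0 :: "real \<Rightarrow> complex" and p1 p2 t0 x0 :: real
  assumes f_deriv: "\<And>p. (f has_real_derivative f1 p) (at p)"
    and f1_cont: "continuous_on UNIV f1"
    and u0: "schwartz u0"
    and band: "supp (fourier u0) \<subseteq> {p1..p2}"
begin

text \<open>
  The Fourier transform of the packet at time \<open>t0\<close>, recentred at \<open>x0\<close>.
\<close>

definition profile :: "real \<Rightarrow> complex" where
  "profile p = fourier u0 p * cis (x0 * p - t0 * f p)"

definition profile' :: "real \<Rightarrow> complex" where
  "profile' p = (fourier (\<lambda>x. - \<i> * (of_real x * u0 x)) p
     + fourier u0 p * (\<i> * of_real (x0 - t0 * f1 p))) * cis (x0 * p - t0 * f p)"

abbreviation weighted_norm :: real where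
  "weighted_norm \<equiv> L2_norm (\<lambda>y. of_real (y - x0) * wave_packet f u0 t0 y)"

lemma fourier_zero: "p \<notin> {p1..p2} \<Longrightarrow> fourier u0 p = 0"
  using band closure_subset[of "{p. fourier u0 p \<noteq> 0}"] unfolding supp_def by auto

lemma profile_zero: "p \<notin> {p1..p2} \<Longrightarrow> profile p = 0"
  by (simp add: profile_def fourier_zero)

lemma norm_profile_le: "cmod (profile p) \<le> L1_norm u0"
  by (simp add: profile_def norm_mult norm_fourier_le)

lemma fourier_u0_deriv:
  "(fourier u0 has_vector_derivative fourier (\<lambda>x. - \<i> * (of_real x * u0 x)) p) (at p)"
  using schwartz_weighted_integrable[OF u0, of 0] schwartz_weighted_integrable[OF u0, of 1]
  by (intro fourier_has_vector_derivative) simp_all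

lemma fourier_weighted_cont: "continuous_on UNIV (fourier (\<lambda>x. - \<i> * (of_real x * u0 x)))"
proof -
  have "integrable lborel (\<lambda>x. - \<i> * (of_real x * u0 x))"
    using schwartz_weighted_integrable[OF u0, of 1] by (intro integrable_mult_right) simp
  moreover have "integrable lborel (\<lambda>x. of_real x * (- \<i> * (of_real x * u0 x)))"
  proof -
    have "integrable lborel (\<lambda>x. - \<i> * (of_real x ^ 2 * u0 x))"
      by (intro integrable_mult_right schwartz_weighted_integrable u0)
    then show ?thesis by (simp add: power2_eq_square mult_ac)
  qed
  ultimately show ?thesis
    by (intro continuous_at_imp_continuous_on ballI
        has_vector_derivative_continuous[OF fourier_has_vector_derivative])
qed

lemma f_cont: "continuous_on UNIV f"
  using f_deriv by (meson continuous_at_imp_continuous_on DERIV_isCont)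

lemma fourier_cont: "continuous_on UNIV (fourier u0)"
  by (intro continuous_at_imp_continuous_on ballI has_vector_derivative_continuous[OF fourier_u0_deriv])

lemma profile_deriv: "(profile has_vector_derivative profile' p) (at p)"
proof -
  have "((\<lambda>p. x0 * p - t0 * f p) has_real_derivative x0 * 1 - t0 * f1 p) (at p)"
    by (intro DERIV_diff DERIV_cmult DERIV_ident f_deriv)
  then have "((\<lambda>p. x0 * p - t0 * f p) has_vector_derivative x0 - t0 * f1 p) (at p)"
    by (simp add: has_real_derivative_iff_has_vector_derivative)
  from vector_diff_chain_at[OF this has_vector_derivative_cis]
  have "((\<lambda>p. cis (x0 * p - t0 * f p)) has_vector_derivative
      of_real (x0 - t0 * f1 p) * (\<i> * cis (x0 * p - t0 * f p))) (at p)"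
    unfolding o_def scaleR_conv_of_real .
  from has_vector_derivative_mult[OF fourier_u0_deriv this] show ?thesis
    unfolding profile_def[abs_def]
    by (rule has_vector_derivative_eq_rhs) (simp add: profile'_def algebra_simps)
qed

lemma profile_cont: "continuous_on UNIV profile"
  by (intro continuous_at_imp_continuous_on ballI has_vector_derivative_continuous[OF profile_deriv])

lemma profile'_cont: "continuous_on UNIV profile'"
  unfolding profile'_def[abs_def]
  by (intro continuous_on_mult continuous_on_add continuous_on_cis continuous_on_diff continuous_on_const
      continuous_on_of_real continuous_on_id fourier_weighted_cont fourier_cont f1_cont f_cont)

lemma profile_boundary: "profile p1 = 0" "profile p2 = 0"
  using continuous_zero_boundary[OF profile_cont profile_zero] by auto

lemma profile'_zero:
  assumes "p \<notin> {p1..p2}"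
  shows "profile' p = 0"
proof -
  have "((\<lambda>_. 0) has_vector_derivative profile' p) (at p)"
    by (rule has_vector_derivative_transform_within_open[OF profile_deriv, where S = "- {p1..p2}"])
       (use assms profile_zero in auto)
  then show ?thesis
    using vector_derivative_unique_at has_vector_derivative_const by blast
qed

lemma wave_packet_eq:
  assumes "{p1..p2} \<subseteq> {a..b}"
  shows "wave_packet f u0 t x =
    1 / (2 * of_real pi) * integral {a..b} (\<lambda>p. profile p * cis (- ((t - t0) * f p - (x - x0) * p)))"
proof -
  have "fourier u0 p * exp (- \<i> * of_real t * of_real (f p) + \<i> * of_real x * of_real p) =
      profile p * cis (- ((t - t0) * f p - (x - x0) * p))" for p
    by (simp add: profile_def cis_conv_exp mult.assoc flip: exp_add) (simp add: algebra_simps)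
  then have "wave_packet f u0 t x =
      1 / (2 * of_real pi) * (LINT p|lborel. profile p * cis (- ((t - t0) * f p - (x - x0) * p)))"
    by (simp add: wave_packet_def)
  also have "(LINT p|lborel. profile p * cis (- ((t - t0) * f p - (x - x0) * p))) =
      integral {a..b} (\<lambda>p. profile p * cis (- ((t - t0) * f p - (x - x0) * p)))"
    by (rule LINT_continuous_compact_support)
       (use assms profile_zero in \<open>auto intro!: continuous_on_mult continuous_on_cis continuous_on_minus
          continuous_on_diff continuous_on_const continuous_on_id profile_cont f_cont\<close>)
  finally show ?thesis .
qed

text \<open>
  By an integration by parts the inverse transform of \<open>profile'\<close> is \<open>- i y u_f(t0, x0 + y)\<close>. Plancherel's
  identity is applied to \<open>profile'\<close>, which is continuous and compactly supported, so that the decay of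
  \<open>u_f(t0, .)\<close> need not be studied.
\<close>

lemma profile'_energy:
  assumes ab: "a \<le> b" and sub: "{p1..p2} \<subseteq> {a..b}" and zero: "profile a = 0" "profile b = 0"
  shows "integral {a..b} (\<lambda>p. (cmod (profile' p))\<^sup>2) = 2 * pi * weighted_norm\<^sup>2"
proof -
  define h where "h y = (LINT p|lborel. profile' p * cis (p * y))" for y
  have h_eq: "h y = - \<i> * of_real y * (2 * of_real pi * wave_packet f u0 t0 (x0 + y))" for y
  proof -
    let ?g = "\<lambda>p. profile p * cis (p * y)"
    have "((\<lambda>p. cis (p * y)) has_vector_derivative of_real y * (\<i> * cis (p * y))) (at p)" for p
    proof -
      have "((\<lambda>p. p * y) has_vector_derivative y) (at p)"
        by (auto intro!: derivative_eq_intros)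
      from vector_diff_chain_at[OF this has_vector_derivative_cis] show ?thesis
        unfolding o_def scaleR_conv_of_real .
    qed
    note d = has_vector_derivative_mult[OF profile_deriv this]
    have "((\<lambda>p. profile p * (of_real y * (\<i> * cis (p * y))) + profile' p * cis (p * y)) has_integral
        ?g b - ?g a) {a..b}"
      by (rule fundamental_theorem_of_calculus[OF ab]) (rule has_vector_derivative_at_within[OF d])
    then have 1: "((\<lambda>p. profile p * (of_real y * (\<i> * cis (p * y))) + profile' p * cis (p * y)) has_integral 0) {a..b}"
      using zero by simp
    have "continuous_on {a..b} ?g"
      by (intro continuous_on_mult continuous_on_cis continuous_on_id continuous_on_const
          continuous_on_subset[OF profile_cont]) auto
    then have "(?g has_integral integral {a..b} ?g) {a..b}"
      by (intro integrable_integral integrable_continuous_interval)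
    from has_integral_diff[OF 1 has_integral_mult_right[OF this, of "of_real y * \<i>"]]
    have "integral {a..b} (\<lambda>p. profile' p * cis (p * y)) = - (of_real y * \<i> * integral {a..b} ?g)"
      by (intro integral_unique) (simp add: algebra_simps)
    moreover have "h y = integral {a..b} (\<lambda>p. profile' p * cis (p * y))"
      unfolding h_def
      by (rule LINT_continuous_compact_support)
         (use sub profile'_zero in \<open>auto intro!: continuous_on_mult continuous_on_cis continuous_on_id
           continuous_on_const profile'_cont\<close>)
    moreover have "integral {a..b} ?g = 2 * of_real pi * wave_packet f u0 t0 (x0 + y)"
      unfolding wave_packet_eq[OF sub] by (simp add: mult.commute)
    ultimately show ?thesis by simp
  qed
  have "2 * pi * integral {a..b} (\<lambda>p. (cmod (profile' p))\<^sup>2) = (LINT y|lborel. (cmod (h y))\<^sup>2)"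
    by (rule plancherel_compact_support(2)[OF profile'_cont _ h_def, symmetric])
       (use sub profile'_zero in auto)
  also have "\<dots> = (LINT y|lborel. (2 * pi)\<^sup>2 * (cmod (of_real y * wave_packet f u0 t0 (x0 + y)))\<^sup>2)"
    unfolding h_eq by (intro Bochner_Integration.integral_cong) (simp_all add: norm_mult power_mult_distrib)
  also have "\<dots> = (2 * pi)\<^sup>2 * (LINT y|lborel. (cmod (of_real y * wave_packet f u0 t0 (x0 + y)))\<^sup>2)"
    by (rule integral_mult_right_zero)
  also have "(LINT y|lborel. (cmod (of_real y * wave_packet f u0 t0 (x0 + y)))\<^sup>2) =
      (LINT y|lborel. (cmod (of_real (y - x0) * wave_packet f u0 t0 y))\<^sup>2)"
    by (subst (2) lborel_integral_real_affine[of 1 _ x0]) simp_all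
  also have "\<dots> = weighted_norm\<^sup>2"
    unfolding L2_norm_def by (rule real_sqrt_pow2[symmetric]) (simp add: integral_nonneg_AE)
  finally have "2 * pi * integral {a..b} (\<lambda>p. (cmod (profile' p))\<^sup>2) = (2 * pi) * (2 * pi * weighted_norm\<^sup>2)"
    by (simp add: power2_eq_square)
  then show ?thesis by simp
qed

lemma weighted_norm_nonneg: "0 \<le> weighted_norm"
  unfolding L2_norm_def by (simp add: integral_nonneg_AE)

end

section \<open>Norms of the symbol and comparison of constants\<close>

text \<open>
  The set where \<open>|g|\<close> is at most its essential supremum is closed and contains almost every point of
  the open interval, hence all of the closed interval.
\<close>

lemma abs_le_Linf_norm:
  assumes ab: "a < b" and g: "continuous_on {a..b} g" and x: "x \<in> {a..b}"
  shows "\<bar>g x\<bar> \<le> Linf_norm a b g"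
proof -
  let ?M = "restrict_space lborel {a<..<b}" and ?h = "\<lambda>x. ereal \<bar>g x\<bar>"
  let ?E = "esssup ?M ?h"
  have cont: "continuous_on {a..b} ?h"
    by (intro continuous_on_ereal continuous_on_rabs g)
  have meas: "?h \<in> borel_measurable ?M"
  proof -
    have "?h \<in> borel_measurable (restrict_space borel {a<..<b})"
      by (intro borel_measurable_continuous_on_restrict continuous_on_subset[OF cont]) auto
    then show ?thesis
      by (simp cong: measurable_cong_sets add: sets_restrict_space_cong[OF sets_lborel])
  qed
  have "bounded (g ` {a..b})"
    using g by (intro compact_imp_bounded compact_continuous_image) auto
  then obtain B where B: "\<And>y. y \<in> {a..b} \<Longrightarrow> \<bar>g y\<bar> \<le> B"
    unfolding bounded_iff real_norm_def by blast
  have E_le: "?E \<le> ereal B"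
    using B by (intro esssup_I meas AE_I2) (auto simp: space_restrict_space)
  let ?C = "{y \<in> {a..b}. ?h y \<in> {..?E}}"
  have C: "closed ?C"
    using continuous_closed_preimage[OF cont, of "{..?E}"] by (simp add: vimage_def Int_def)
  have "AE y in ?M. ?h y \<le> ?E" by (rule esssup_AE)
  then have AE: "AE y in lborel. y \<in> {a<..<b} \<longrightarrow> ?h y \<le> ?E"
    by (subst (asm) AE_restrict_space_iff) auto
  have inner: "{a<..<b} \<subseteq> ?C"
  proof
    fix y assume y: "y \<in> {a<..<b}"
    have "AE z in lebesgue. z \<in> {a<..<b} \<longrightarrow> z \<in> ?C"
      using AE by (intro AE_completion) (auto elim!: eventually_mono)
    then show "y \<in> ?C"
      using mem_closed_if_AE_lebesgue_open[OF _ C _ y] by auto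
  qed
  have "x \<in> closure {a<..<b}" using x ab by simp
  then have "x \<in> ?C" using closure_minimal[OF inner C] by blast
  then have "?h x \<le> ?E" by simp
  moreover have "?E \<noteq> \<infinity>" "?E \<noteq> - \<infinity>" using E_le \<open>?h x \<le> ?E\<close> by auto
  ultimately show ?thesis
    unfolding Linf_norm_def by (cases ?E) auto
qed

lemma min_on_le: "min_on a b g \<le> g x"
  and min_on_pos: "0 < min_on a b g"
  if pos: "\<And>y. 0 < g y" and g: "continuous_on {a..b} g" and x: "x \<in> {a..b}"
proof -
  have bdd: "bdd_below (g ` {a..b})"
    using pos by (intro bdd_belowI[of _ 0]) (auto intro: less_imp_le)
  then show "min_on a b g \<le> g x"
    unfolding min_on_def using x by (rule cINF_lower)
  have "\<exists>z\<in>{a..b}. \<forall>y\<in>{a..b}. g z \<le> g y"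
    by (rule continuous_attains_inf[OF _ _ g]) (use x in auto)
  then obtain z where z: "z \<in> {a..b}" "\<And>y. y \<in> {a..b} \<Longrightarrow> g z \<le> g y" by blast
  have "g z \<le> min_on a b g"
    unfolding min_on_def using x z by (intro cINF_greatest) auto
  with pos[of z] show "0 < min_on a b g" by linarith
qed

lemma symbol_class_deriv:
  assumes "symbol_class f"
  shows "((deriv ^^ k) f has_real_derivative (deriv ^^ Suc k) f x) (at x)"
proof -
  have "(deriv ^^ k) f differentiable (at x)" using assms by (auto simp: symbol_class_def)
  then show ?thesis by (simp add: DERIV_deriv_iff_real_differentiable)
qed

text \<open>
  The stated constants exceed the ones obtained above by a nonnegative power of \<open>M / m\<close> and a factor
  at least 1. This monotonicity is how they are compared.
\<close>

lemma powr_shift_le: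
  fixes m M :: real
  assumes "0 < m" "m \<le> M" "0 \<le> e"
  shows "M powr a * m powr b \<le> M powr (a + e) * m powr (b - e)"
proof -
  have "m powr e \<le> M powr e" using assms by (intro powr_mono2) auto
  then have "1 \<le> M powr e * m powr (- e)"
    using assms by (simp add: powr_minus_divide)
  then have "M powr a * m powr b * 1 \<le> M powr a * m powr b * (M powr e * m powr (- e))"
    by (intro mult_left_mono) auto
  also have "\<dots> = M powr (a + e) * m powr (b + - e)"
    unfolding powr_add by (simp only: mult_ac)
  finally show ?thesis by simp
qed

text \<open>
  A factor \<open>sqrt 2\<close> and a factor \<open>(M / m)^(1 / 2)\<close> are lost.
\<close>

lemma derivative_constant_le:
  fixes m M d N \<delta> :: real
  assumes m: "0 < m" "m \<le> M" and d: "0 \<le> d" and N: "0 \<le> N" and \<delta>: "1 / 2 < \<delta>" "\<delta> < 3 / 4"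
  shows "1 / (2 * pi) * (L_const \<delta> * (2 powr \<delta> * M powr (1 - \<delta>) / m *
      sqrt (2 * pi * N\<^sup>2 * (2 * d powr (3 - 4 * \<delta>) / (3 - 4 * \<delta>)))))
    \<le> 2 powr (\<delta> + 1 / 2) * L_const \<delta> / (sqrt pi * sqrt (3 - 4 * \<delta>)) * d powr ((3 - 4 * \<delta>) / 2)
      * M powr (3 / 2 - \<delta>) * m powr (- 3 / 2) * N"
proof -
  have L: "0 \<le> L_const \<delta>" by (simp add: L_const_def)
  have dd: "sqrt (d powr (3 - 4 * \<delta>)) = d powr ((3 - 4 * \<delta>) / 2)"
    using d by (simp add: powr_half_sqrt[symmetric] powr_powr)
  have "sqrt (2 * pi * N\<^sup>2 * (2 * d powr (3 - 4 * \<delta>) / (3 - 4 * \<delta>))) =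
      sqrt (2\<^sup>2) * sqrt pi * sqrt (N\<^sup>2) * sqrt (d powr (3 - 4 * \<delta>)) / sqrt (3 - 4 * \<delta>)"
    unfolding real_sqrt_mult[symmetric] real_sqrt_divide[symmetric] by (simp add: mult_ac)
  also have "\<dots> = 2 * sqrt pi * N * d powr ((3 - 4 * \<delta>) / 2) / sqrt (3 - 4 * \<delta>)"
    unfolding dd using N by simp
  finally have S: "sqrt (2 * pi * N\<^sup>2 * (2 * d powr (3 - 4 * \<delta>) / (3 - 4 * \<delta>))) = \<dots>" .
  have pi: "1 / (2 * pi) * (2 * sqrt pi) = 1 / sqrt pi"
    by (simp add: field_simps)
  have m1: "M powr (1 - \<delta>) / m = M powr (1 - \<delta>) * m powr (- 1)"
    using m by (simp add: powr_minus_divide)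
  let ?k = "L_const \<delta> / (sqrt pi * sqrt (3 - 4 * \<delta>)) * d powr ((3 - 4 * \<delta>) / 2) * N"
  have k: "0 \<le> ?k" using L N \<delta> by (intro mult_nonneg_nonneg divide_nonneg_nonneg) auto
  have "1 / (2 * pi) * (L_const \<delta> * (2 powr \<delta> * M powr (1 - \<delta>) / m *
      (2 * sqrt pi * N * d powr ((3 - 4 * \<delta>) / 2) / sqrt (3 - 4 * \<delta>)))) =
      (1 / (2 * pi) * (2 * sqrt pi)) * (L_const \<delta> / sqrt (3 - 4 * \<delta>) * d powr ((3 - 4 * \<delta>) / 2) * N)
        * (2 powr \<delta> * (M powr (1 - \<delta>) / m))"
    by (simp only: times_divide_eq_left times_divide_eq_right mult_ac divide_divide_eq_left)
  also have "\<dots> = ?k * (2 powr \<delta> * (M powr (1 - \<delta>) * m powr (- 1)))"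
    unfolding pi m1 by simp
  also have "\<dots> \<le> ?k * (2 powr (\<delta> + 1 / 2) * (M powr (1 - \<delta> + 1 / 2) * m powr (- 1 - 1 / 2)))"
    by (intro mult_left_mono[OF _ k] mult_mono powr_shift_le m powr_mono) auto
  also have "\<dots> = 2 powr (\<delta> + 1 / 2) * L_const \<delta> / (sqrt pi * sqrt (3 - 4 * \<delta>)) * d powr ((3 - 4 * \<delta>) / 2)
      * M powr (3 / 2 - \<delta>) * m powr (- 3 / 2) * N"
    by simp
  finally show ?thesis unfolding S .
qed

text \<open>
  After dividing out common factors this is \<open>X / 6 \<le> (Y + Z / 3) / 4\<close> with \<open>X \<le> Y\<close>, the quotient of
  \<open>Y\<close> by \<open>X\<close> being \<open>(M / m)^(3 / 2 - \<delta>)\<close>.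
\<close>

lemma sup_constant_le:
  fixes m M T d K \<delta> :: real
  assumes m: "0 < m" "m \<le> M" and T: "0 \<le> T" and d: "0 \<le> d" and K: "0 \<le> K" and \<delta>: "1 / 2 < \<delta>" "\<delta> < 3 / 4"
  shows "1 / (2 * pi) * (L_const \<delta> * (2 powr \<delta> * T * M * m powr (- 2 - \<delta>) / 3 * K * (d powr (2 - 2 * \<delta>) / (1 - \<delta>))))
    \<le> 2 powr (\<delta> - 2) * L_const \<delta> / (pi * (1 - \<delta>)) * d powr (2 - 2 * \<delta>) *
      (M powr (5 / 2 - \<delta>) * T * m powr (- 7 / 2) + 1 / 3 * M powr (7 / 2 - \<delta>) * T * m powr (- 9 / 2)) * K"
proof -
  have L: "0 \<le> L_const \<delta>" by (simp add: L_const_def)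
  let ?k = "L_const \<delta> / (pi * (1 - \<delta>)) * d powr (2 - 2 * \<delta>) * K * T * 2 powr \<delta>"
  have k: "0 \<le> ?k" using L K T \<delta> by (intro mult_nonneg_nonneg divide_nonneg_nonneg) auto
  have M: "M = M powr 1" using m by simp
  have "1 / (2 * pi) * (L_const \<delta> * (2 powr \<delta> * T * M * m powr (- 2 - \<delta>) / 3 * K * (d powr (2 - 2 * \<delta>) / (1 - \<delta>)))) =
      ?k * (1 / 6 * (M * m powr (- 2 - \<delta>)))"
    using \<delta> by (simp add: field_simps)
  also have "\<dots> \<le> ?k * (1 / 4 * (M powr (5 / 2 - \<delta>) * m powr (- 7 / 2) + 1 / 3 * M powr (7 / 2 - \<delta>) * m powr (- 9 / 2)))"
  proof (rule mult_left_mono[OF _ k])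
    have weaken: "1 / 6 * X \<le> 1 / 4 * (Y + 1 / 3 * Z)" if "X \<le> Y" "0 \<le> X" "0 \<le> Z" for X Y Z :: real
    proof -
      have "1 / 6 * X \<le> 1 / 4 * X" "1 / 4 * X \<le> 1 / 4 * Y" "0 \<le> 1 / 4 * (1 / 3 * Z)" using that by auto
      then show ?thesis unfolding distrib_left by (meson add_increasing2 order_trans)
    qed
    have "M powr 1 * m powr (- 2 - \<delta>) \<le> M powr (1 + (3 / 2 - \<delta>)) * m powr (- 2 - \<delta> - (3 / 2 - \<delta>))"
      using \<delta> by (intro powr_shift_le m) auto
    then have "M * m powr (- 2 - \<delta>) \<le> M powr (5 / 2 - \<delta>) * m powr (- 7 / 2)"
      using m by (simp add: algebra_simps)
    moreover have "0 \<le> M * m powr (- 2 - \<delta>)" "0 \<le> M powr (7 / 2 - \<delta>) * m powr (- 9 / 2)"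
      using m by auto
    ultimately show "1 / 6 * (M * m powr (- 2 - \<delta>))
        \<le> 1 / 4 * (M powr (5 / 2 - \<delta>) * m powr (- 7 / 2) + 1 / 3 * M powr (7 / 2 - \<delta>) * m powr (- 9 / 2))"
      unfolding mult.assoc by (rule weaken)
  qed
  also have "\<dots> = (2 powr \<delta> / 4) * L_const \<delta> / (pi * (1 - \<delta>)) * d powr (2 - 2 * \<delta>) *
      (M powr (5 / 2 - \<delta>) * T * m powr (- 7 / 2) + 1 / 3 * M powr (7 / 2 - \<delta>) * T * m powr (- 9 / 2)) * K"
    by (simp add: algebra_simps add_divide_distrib)
  also have "2 powr \<delta> / 4 = 2 powr (\<delta> - 2)"
    by (simp add: powr_diff)
  finally show ?thesis .
qed

section \<open>The estimate inside and outside the cone\<close>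

theorem theorem3p2:
  fixes p1 p2 q1 q2 t0 x0 :: real
    and f :: "real \<Rightarrow> real"
    and u0 :: "real \<Rightarrow> complex"
  assumes "p1 < p2" and "q1 < q2" and "{p1..p2} \<subseteq> {q1<..<q2}"
    and "symbol_class f" and "\<And>p. (deriv ^^ 2) f p > 0"
    and "schwartz u0" and "supp (fourier u0) \<subseteq> {p1..p2}"
  shows "(\<forall>\<delta>\<in>{1/2<..<3/4}. \<forall>(t, x)\<in>st_cone f q1 q2 t0 x0.
            let p0 = stat_point f t0 x0 t x in
            cmod (wave_packet f u0 t x
                  - 1 / of_real (sqrt (2 * pi))
                    * exp (- of_real (sgn (t - t0)) * \<i> * of_real (pi / 4))
                    * exp (- \<i> * of_real t * of_real (f p0) + \<i> * of_real x * of_real p0)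
                    * (fourier u0 p0 / of_real (sqrt ((deriv ^^ 2) f p0)))
                    * of_real (\<bar>t - t0\<bar> powr (- 1 / 2)))
            \<le> (C5 f \<delta> q1 q2 * L2_norm (\<lambda>y. of_real (y - x0) * wave_packet f u0 t0 y)
               + C6 f \<delta> q1 q2 * L1_norm u0) * \<bar>t - t0\<bar> powr (- \<delta>))
       \<and> (\<forall>(t, x)\<in>st_cone_compl f q1 q2 t0 x0.
            cmod (wave_packet f u0 t x)
            \<le> (C7 f p1 p2 q1 q2 * L2_norm (\<lambda>y. of_real (y - x0) * wave_packet f u0 t0 y)
               + C8 f p1 p2 q1 q2 * L1_norm u0) * inverse \<bar>t - t0\<bar>)"
proof -
  define f1 where "f1 = deriv f"
  define f2 where "f2 = (deriv ^^ 2) f"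
  define f3 where "f3 = (deriv ^^ 3) f"
  have f_deriv: "(f has_real_derivative f1 p) (at p)" for p
    using symbol_class_deriv[OF assms(4), of 0 p] by (simp add: f1_def)
  have f1_deriv: "(f1 has_real_derivative f2 p) (at p)" for p
    using symbol_class_deriv[OF assms(4), of 1 p] by (simp add: f1_def f2_def numeral_2_eq_2)
  have f2_deriv: "(f2 has_real_derivative f3 p) (at p)" for p
    using symbol_class_deriv[OF assms(4), of 2 p] by (simp add: f2_def f3_def numeral_2_eq_2 numeral_3_eq_3)
  have f3_deriv: "(f3 has_real_derivative (deriv ^^ 4) f p) (at p)" for p
    using symbol_class_deriv[OF assms(4), of 3 p] by (simp add: f3_def numeral_3_eq_3 numeral_Bit0)
  have f2_pos: "0 < f2 p" for p using assms(5) by (simp add: f2_def)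
  have cont: "continuous_on S f1" "continuous_on S f2" "continuous_on S f3" for S
    using f1_deriv f2_deriv f3_deriv by (meson continuous_at_imp_continuous_on DERIV_isCont)+
  have f1_less: "f1 a < f1 b" if "a < b" for a b
    using that by (rule DERIV_pos_imp_increasing) (use f1_deriv f2_pos in blast)
  have f1_le: "f1 a \<le> f1 b" if "a \<le> b" for a b
    using that f1_less[of a b] by (cases "a = b") auto
  have inj: "inj f1"
    by (rule injI) (metis f1_less less_irrefl linorder_less_linear)
  have "p1 \<in> {q1<..<q2}" "p2 \<in> {q1<..<q2}"
    by (rule subsetD[OF assms(3)], use assms(1) in simp)+
  then have q: "q1 < p1" "p2 < q2" by auto
  have sub: "{p1..p2} \<subseteq> {q1..q2}" using q by auto

  interpret band_limited_packet f f1 u0 p1 p2 t0 x0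
    by unfold_locales (use f_deriv cont assms in auto)

  let ?N = weighted_norm and ?K = "L1_norm u0"
  have K0: "0 \<le> ?K" using order_trans[OF norm_ge_zero norm_profile_le] .
  have N0: "0 \<le> ?N" by (rule weighted_norm_nonneg)
  have q_zero: "profile q1 = 0" "profile q2 = 0" using q assms(1) by (auto intro!: profile_zero)
  have energy_q: "integral {q1..q2} (\<lambda>p. (cmod (profile' p))\<^sup>2) = 2 * pi * ?N\<^sup>2"
    by (rule profile'_energy[OF less_imp_le[OF assms(2)] sub q_zero])
  have energy_p: "integral {p1..p2} (\<lambda>p. (cmod (profile' p))\<^sup>2) = 2 * pi * ?N\<^sup>2"
    by (rule profile'_energy[OF less_imp_le[OF assms(1)] order_refl profile_boundary])
  have prof'_cont: "continuous_on S profile'" for S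
    using profile'_cont by (rule continuous_on_subset) simp

  define m M T where "m = min_on q1 q2 f2" and "M = Linf_norm q1 q2 f2" and "T = Linf_norm q1 q2 f3"
  have m: "0 < m" unfolding m_def by (rule min_on_pos[OF f2_pos cont(2), of q1]) (use assms(2) in auto)
  have f2_bounds: "m \<le> f2 p \<and> f2 p \<le> M" if "p \<in> {q1..q2}" for p
    using min_on_le[OF f2_pos cont(2) that] abs_le_Linf_norm[OF assms(2) cont(2) that] f2_pos[of p]
    by (simp add: m_def M_def)
  have f3_bound: "\<bar>f3 p\<bar> \<le> T" if "p \<in> {q1..q2}" for p
    unfolding T_def by (rule abs_le_Linf_norm[OF assms(2) cont(3) that])
  have mM: "m \<le> M" using f2_bounds[of q1] assms(2) by auto
  have T0: "0 \<le> T" using f3_bound[of q1] assms(2) by auto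

  interpret phase: convex_phase f f1 f2 f3 q1 q2 m M T
    by unfold_locales (use f_deriv f1_deriv f2_deriv m f2_bounds f3_bound in auto)

  have inside: "let p0 = stat_point f t0 x0 t x in
      cmod (wave_packet f u0 t x
        - 1 / of_real (sqrt (2 * pi)) * exp (- of_real (sgn (t - t0)) * \<i> * of_real (pi / 4))
          * exp (- \<i> * of_real t * of_real (f p0) + \<i> * of_real x * of_real p0)
          * (fourier u0 p0 / of_real (sqrt ((deriv ^^ 2) f p0))) * of_real (\<bar>t - t0\<bar> powr (- 1 / 2)))
      \<le> (C5 f \<delta> q1 q2 * ?N + C6 f \<delta> q1 q2 * ?K) * \<bar>t - t0\<bar> powr (- \<delta>)"
    if \<delta>: "1 / 2 < \<delta>" "\<delta> < 3 / 4" and cone: "(t, x) \<in> st_cone f q1 q2 t0 x0" for \<delta> t x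
  proof -
    define s where "s = t - t0"
    define v where "v = (x - x0) / s"
    have s: "s \<noteq> 0" and v: "f1 q1 \<le> v" "v \<le> f1 q2"
      using cone by (auto simp: st_cone_def s_def v_def f1_def)
    obtain p0 where p0: "p0 \<in> {q1..q2}" "f1 p0 = v"
      using IVT'[OF v less_imp_le[OF assms(2)] cont(1)] by auto
    have stat: "stat_point f t0 x0 t x = p0"
      using inj p0(2) by (simp add: stat_point_def v_def[symmetric] s_def[symmetric] f1_def[symmetric] inv_f_eq)
    have xv: "x - x0 = s * v" using s by (simp add: v_def)
    let ?I = "integral {q1..q2} (\<lambda>p. profile p * cis (- (s * (f p - f p0 - f1 p0 * (p - p0)))))"
    let ?main = "profile p0 * of_real (sqrt (2 * pi / f2 p0) * \<bar>s\<bar> powr (- 1 / 2)) * cis (- (sgn s * (pi / 4)))"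
    let ?c = "cis (- (s * f p0 - (x - x0) * p0))"
    have packet: "wave_packet f u0 t x = 1 / (2 * of_real pi) * (?I * ?c)"
    proof -
      have phase: "- (s * f p - (x - x0) * p) =
          - (s * (f p - f p0 - f1 p0 * (p - p0))) + - (s * f p0 - (x - x0) * p0)" for p
        unfolding xv p0(2) by (simp add: algebra_simps)
      have split: "cis (- (s * f p - (x - x0) * p)) = cis (- (s * (f p - f p0 - f1 p0 * (p - p0)))) * ?c" for p
        by (simp only: cis_mult phase[of p])
      have "integral {q1..q2} (\<lambda>p. profile p * cis (- (s * f p - (x - x0) * p))) =
          integral {q1..q2} (\<lambda>p. profile p * cis (- (s * (f p - f p0 - f1 p0 * (p - p0)))) * ?c)"
        by (intro Henstock_Kurzweil_Integration.integral_cong, subst split) (rule mult.assoc[symmetric])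
      also have "\<dots> = ?I * ?c"
        by (rule Henstock_Kurzweil_Integration.integral_mult_left)
      finally show ?thesis
        unfolding wave_packet_eq[OF sub] s_def[symmetric] by (simp only:)
    qed
    \<comment> \<open>The phase at the stationary point, split off from the integral, is common to the packet and its leading term.\<close>
    have leading: "1 / of_real (sqrt (2 * pi)) * exp (- of_real (sgn s) * \<i> * of_real (pi / 4))
          * exp (- \<i> * of_real t * of_real (f p0) + \<i> * of_real x * of_real p0)
          * (fourier u0 p0 / of_real (sqrt (f2 p0))) * of_real (\<bar>s\<bar> powr (- 1 / 2))
        = 1 / (2 * of_real pi) * (?main * ?c)"
    proof -
      have e1: "exp (- of_real (sgn s) * \<i> * of_real (pi / 4)) = cis (- (sgn s * (pi / 4)))"
        by (simp add: cis_conv_exp mult_ac)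
      have "- \<i> * of_real t * of_real (f p0) + \<i> * of_real x * of_real p0 = \<i> * of_real (x * p0 - t * f p0)"
        by (simp add: algebra_simps)
      then have e2: "exp (- \<i> * of_real t * of_real (f p0) + \<i> * of_real x * of_real p0) = cis (x * p0 - t * f p0)"
        by (simp only: cis_conv_exp)
      have e3: "fourier u0 p0 * cis (x * p0 - t * f p0) = profile p0 * ?c"
        unfolding profile_def mult.assoc cis_mult
        by (rule arg_cong[where f = "\<lambda>y. fourier u0 p0 * cis y"]) (simp add: s_def algebra_simps)
      have e4: "1 / sqrt (2 * pi) / sqrt (f2 p0) = 1 / (2 * pi) * sqrt (2 * pi / f2 p0)"
      proof -
        have "1 / sqrt (2 * pi) = 1 / (2 * pi) * sqrt (2 * pi)"
          by (simp add: field_simps flip: real_sqrt_mult)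
        then show ?thesis by (simp only: real_sqrt_divide times_divide_eq_right)
      qed
      have "1 / of_real (sqrt (2 * pi)) * exp (- of_real (sgn s) * \<i> * of_real (pi / 4))
          * exp (- \<i> * of_real t * of_real (f p0) + \<i> * of_real x * of_real p0)
          * (fourier u0 p0 / of_real (sqrt (f2 p0))) * of_real (\<bar>s\<bar> powr (- 1 / 2))
        = of_real (1 / sqrt (2 * pi) / sqrt (f2 p0)) * (fourier u0 p0 * cis (x * p0 - t * f p0))
          * of_real (\<bar>s\<bar> powr (- 1 / 2)) * cis (- (sgn s * (pi / 4)))"
        unfolding e1 e2 unfolding of_real_divide of_real_1 by (simp add: mult_ac)
      also have "\<dots> = 1 / (2 * of_real pi) * (?main * ?c)"
        unfolding e3 e4 of_real_mult of_real_divide of_real_1 of_real_numeral by (simp only: mult_ac)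
      finally show ?thesis .
    qed
    let ?A = "2 powr \<delta> * M powr (1 - \<delta>) / m *
        sqrt (2 * pi * ?N\<^sup>2 * (2 * (q2 - q1) powr (3 - 4 * \<delta>) / (3 - 4 * \<delta>)))"
    let ?B = "2 powr \<delta> * T * M * m powr (- 2 - \<delta>) / 3 * ?K * ((q2 - q1) powr (2 - 2 * \<delta>) / (1 - \<delta>))"
    have "cmod (?I - ?main) \<le> L_const \<delta> * (?A + ?B) * \<bar>s\<bar> powr (- \<delta>)"
      using phase.stationary_phase_bound[OF s p0(1) profile_deriv prof'_cont q_zero norm_profile_le \<delta>]
      unfolding energy_q .
    then have "1 / (2 * pi) * cmod (?I - ?main) \<le> 1 / (2 * pi) * (L_const \<delta> * (?A + ?B) * \<bar>s\<bar> powr (- \<delta>))"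
      by (intro mult_left_mono) auto
    also have "\<dots> = (1 / (2 * pi) * (L_const \<delta> * ?A) + 1 / (2 * pi) * (L_const \<delta> * ?B)) * \<bar>s\<bar> powr (- \<delta>)"
      by (simp only: distrib_left distrib_right mult.assoc)
    also have "\<dots> \<le> (C5 f \<delta> q1 q2 * ?N + C6 f \<delta> q1 q2 * ?K) * \<bar>s\<bar> powr (- \<delta>)"
      unfolding C5_def C6_def f2_def[symmetric] f3_def[symmetric] m_def[symmetric] M_def[symmetric] T_def[symmetric]
      using assms(2) by (intro mult_right_mono add_mono derivative_constant_le sup_constant_le m mM T0 N0 K0 \<delta>) auto
    also have "1 / (2 * pi) * cmod (?I - ?main) = cmod (1 / (2 * of_real pi) * (?I * ?c) - 1 / (2 * of_real pi) * (?main * ?c))"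
    proof -
      have "1 / (2 * of_real pi) * (?I * ?c) - 1 / (2 * of_real pi) * (?main * ?c) = 1 / (2 * of_real pi) * (?I - ?main) * ?c"
        by (simp only: left_diff_distrib right_diff_distrib mult.assoc)
      then show ?thesis by (simp add: norm_mult norm_divide)
    qed
    finally show ?thesis
      unfolding stat Let_def f2_def[symmetric] s_def[symmetric] leading packet .
  qed

  have outside: "cmod (wave_packet f u0 t x) \<le> (C7 f p1 p2 q1 q2 * ?N + C8 f p1 p2 q1 q2 * ?K) * inverse \<bar>t - t0\<bar>"
    if compl: "(t, x) \<in> st_cone_compl f q1 q2 t0 x0" for t x
  proof -
    define s where "s = t - t0"
    define v where "v = (x - x0) / s"
    define \<mu> where "\<mu> = min (f1 p1 - f1 q1) (f1 q2 - f1 p2)"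
    have s: "s \<noteq> 0" and v: "v < f1 q1 \<or> f1 q2 < v"
      using compl by (auto simp: st_cone_compl_def st_cone_def s_def v_def f1_def)
    have \<mu>: "0 < \<mu>" using f1_less q by (simp add: \<mu>_def)
    \<comment> \<open>Left of the cone the phase derivative is smallest at \<open>p1\<close>, right of it largest at \<open>p2\<close>.\<close>
    have away: "(\<forall>p\<in>{p1..p2}. \<mu> \<le> f1 p - v) \<or> (\<forall>p\<in>{p1..p2}. f1 p - v \<le> - \<mu>)"
      using v
    proof
      assume v: "v < f1 q1"
      have "\<mu> \<le> f1 p - v" if "p \<in> {p1..p2}" for p
        using f1_le[of p1 p] that v by (auto simp: \<mu>_def min_le_iff_disj)
      then show ?thesis by blast
    next
      assume v: "f1 q2 < v"
      have "f1 p - v \<le> - \<mu>" if "p \<in> {p1..p2}" for p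
        using f1_le[of p p2] that v min.cobounded2[of "f1 p1 - f1 q1" "f1 q2 - f1 p2"] by (simp add: \<mu>_def)
      then show ?thesis by blast
    qed
    have g: "((\<lambda>p. f p - v * p) has_real_derivative f1 p - v) (at p)" for p
      using DERIV_diff[OF f_deriv DERIV_cmult[OF DERIV_ident, of v]] by simp
    have g1: "((\<lambda>p. f1 p - v) has_real_derivative f2 p) (at p)" for p
      using DERIV_diff[OF f1_deriv DERIV_const] by simp
    have xv: "x - x0 = s * v" using s by (simp add: v_def)
    have "wave_packet f u0 t x = 1 / (2 * of_real pi) * integral {p1..p2} (\<lambda>p. profile p * cis (- (s * (f p - v * p))))"
      unfolding wave_packet_eq[OF order_refl] s_def[symmetric] xv by (simp add: algebra_simps)
    then have "cmod (wave_packet f u0 t x) =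
        1 / (2 * pi) * cmod (integral {p1..p2} (\<lambda>p. profile p * cis (- (s * (f p - v * p)))))"
      by (simp add: norm_mult norm_divide)
    also have "\<dots> \<le> 1 / (2 * pi) * ((sqrt (2 * pi * ?N\<^sup>2 * (p2 - p1)) + ?K) / \<mu> * inverse \<bar>s\<bar>)"
      using nonstationary_phase_bound[OF less_imp_le[OF assms(1)] s \<mu> g g1 cont(2) less_imp_le[OF f2_pos]
          away profile_deriv prof'_cont profile_boundary norm_profile_le]
      unfolding energy_p by (intro mult_left_mono) auto
    also have "\<dots> = (C7 f p1 p2 q1 q2 * ?N + C8 f p1 p2 q1 q2 * ?K) * inverse \<bar>s\<bar>"
    proof -
      have r: "sqrt (2 * pi * ?N\<^sup>2 * (p2 - p1)) = sqrt (2 * pi) * ?N * sqrt (p2 - p1)"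
        using N0 by (simp add: real_sqrt_mult)
      have pi: "1 / (2 * pi) * sqrt (2 * pi) = 1 / sqrt (2 * pi)"
        by (simp add: field_simps flip: real_sqrt_mult)
      have "1 / (2 * pi) * ((sqrt (2 * pi) * ?N * sqrt (p2 - p1) + ?K) / \<mu> * inverse \<bar>s\<bar>) =
          ((1 / (2 * pi) * sqrt (2 * pi)) * sqrt (p2 - p1) * inverse \<mu> * ?N + 1 / (2 * pi) * inverse \<mu> * ?K) * inverse \<bar>s\<bar>"
        unfolding divide_inverse[of _ \<mu>] by (simp only: distrib_left distrib_right mult_ac)
      then show ?thesis
        unfolding r pi C7_def C8_def f1_def[symmetric] \<mu>_def[symmetric]
        using assms(1) by (simp only: powr_half_sqrt)
    qed
    finally show ?thesis by (simp only: s_def)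
  qed
  show ?thesis
    using inside outside by auto
qed

end
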